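(* Consider the following compact subset of $C([0,1])$: $$K_0=\{f\in C([0,1]) : \|f\|_\infty\le 1 \text{ and } \|f\|_L\le 1\}.$$ If a Banach space $Y$ contains an isometric copy of $K_0$, then $Y$ contains an isometric copy of every separable metric space, and every separable Banach space is linearly isometric to a subspace of $Y$.
   Context: Banach spaces are real. $C([0,1])$ is the Banach space of continuous real-valued functions on $[0,1]$ with the supremum norm $\|\cdot\|_\infty$; $K_0$ carries the metric induced by this norm. For a function $f$ on $[0,1]$, $\|f\|_L=\sup\{|f(x)-f(y)|/|x-y| : x\neq y \text{ in } [0,1]\}$ is its Lipschitz constant. $Y$ contains an isometric copy of a metric space $M$ if there is a distance-preserving (not necessarily linear or affine) map $M\to Y$. "Linearly isometric to a subspace of $Y$" means that there is a linear norm-preserving map into $Y$. *)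

theory Defs
  imports "HOL-Analysis.Analysis"
begin

text \<open>
  Elements are the continuous functions on \<open>[0,1]\<close>, made extensional (\<^const>\<open>undefined\<close> outside
  \<open>[0,1]\<close>) so that equality means equality on \<open>[0,1]\<close>; boundedness, which \<^const>\<open>cfunspace\<close> also
  demands, is automatic by compactness. The distance of \<open>f\<close> and \<open>g\<close> is
  \<open>SUP x\<in>{0..1}. \<bar>f x - g x\<bar>\<close>, i.e. the metric induced by the supremum norm.
\<close>
definition C01 :: "(real \<Rightarrow> real) metric"
  where "C01 = cfunspace (top_of_set {0..1}) euclidean_metric"

definition sup_norm :: "(real \<Rightarrow> real) \<Rightarrow> real"
  where "sup_norm f = (SUP x\<in>{0..1}. \<bar>f x\<bar>)"

text \<open>Extended-real valued, because the supremum is infinite when \<open>f\<close> is not Lipschitz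
  (a real-valued \<^const>\<open>Sup\<close> would be unspecified there).\<close>
definition lip_norm :: "(real \<Rightarrow> real) \<Rightarrow> ereal"
  where "lip_norm f =
    Sup {ereal (\<bar>f x - f y\<bar> / \<bar>x - y\<bar>) | x y. x \<in> {0..1} \<and> y \<in> {0..1} \<and> x \<noteq> y}"

definition K0 :: "(real \<Rightarrow> real) set"
  where "K0 = {f \<in> mspace C01. sup_norm f \<le> 1 \<and> lip_norm f \<le> 1}"

text \<open>Distance-preserving maps need not be linear, affine or surjective.\<close>
definition contains_isometric_copy :: "'y::metric_space itself \<Rightarrow> 'm metric \<Rightarrow> bool"
  where "contains_isometric_copy (_ :: 'y itself) m \<longleftrightarrow>
    (\<exists>\<phi> :: 'm \<Rightarrow> 'y. \<forall>x\<in>mspace m. \<forall>y\<in>mspace m. dist (\<phi> x) (\<phi> y) = mdist m x y)"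

definition linearly_isometric_into ::
    "'b::real_normed_vector itself \<Rightarrow> 'y::real_normed_vector itself \<Rightarrow> bool"
  where "linearly_isometric_into (_ :: 'b itself) (_ :: 'y itself) \<longleftrightarrow>
    (\<exists>T :: 'b \<Rightarrow> 'y. linear T \<and> (\<forall>x. norm (T x) = norm x))"

end

theory Submission
  imports Defs "HOL-Complex_Analysis.Great_Picard"
begin

text \<open>
  Two facts are combined: an isometric copy of \<open>K0\<close> in \<open>Y\<close> forces a \<^emph>\<open>linear\<close> isometric
  copy of \<open>C([0,1])\<close> in \<open>Y\<close>, and \<open>C([0,1])\<close> is universal for separable spaces. Compactness of
  \<open>K0\<close> is Arzela-Ascoli.

  \<^emph>\<open>From the map \<open>\<phi> : K0 \<rightarrow> Y\<close> back to point evaluations.\<close> The function \<open>p(t) = 1 - \<bar>t - \<tau>\<bar>\<close>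
  and its negative lie in \<open>K0\<close> at distance \<open>2\<close>. If \<open>u\<close> is \<open>1\<close>-Lipschitz and \<open>\<bar>u\<bar> \<le> 1/2\<close>, then
  \<open>\<parallel>p - u\<parallel> = 1 - u(\<tau>)\<close> and \<open>\<parallel>u + p\<parallel> = 1 + u(\<tau>)\<close>, so \<open>u\<close> lies metrically between \<open>p\<close> and \<open>-p\<close>. A
  norm-one functional \<open>F\<close> that is norming for \<open>\<phi> p - \<phi> (-p)\<close> (Hahn-Banach) must therefore satisfy
  \<open>F (\<phi> u - \<phi> v) = u(\<tau>) - v(\<tau>)\<close> for all such \<open>u, v\<close> (\<open>evaluation_functional\<close>). On these
  functions, evaluation at \<open>\<tau>\<close> thus factors, up to a constant, through \<open>\<phi>\<close> and a linear functional of norm one.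

  \<^emph>\<open>From \<open>\<phi>\<close> to a linear map.\<close> Following Godefroy and Kalton, \<open>\<phi>\<close> is smoothed by averaging over
  an infinite-dimensional cube spanned by small multiples \<open>x k\<close> of the monomials. The partial
  derivative of the average in direction \<open>x k\<close> exists, because integrating in the \<open>k\<close>-th
  coordinate turns it into a difference of averages over two opposite faces; call it \<open>R k\<close>. The
  derivative of a \<open>1\<close>-Lipschitz map is a linear contraction, so
  \<open>\<parallel>\<Sum> a k R k\<parallel> \<le> \<parallel>\<Sum> a k x k\<parallel>\<close> (\<open>linearize_lipschitz\<close>). The functionals \<open>F\<close> give the reverse
  inequality: \<open>F (R k) = x k (\<tau>)\<close>. By density of the polynomials, \<open>x k \<mapsto> R k\<close> extends to a
  linear isometry of \<open>C([0,1])\<close> into \<open>Y\<close> (\<open>C01_embeds_linearly\<close>).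

  \<^emph>\<open>Universality of \<open>C([0,1])\<close>\<close> (Banach and Mazur; \<open>universal_C01\<close>). Let \<open>L\<close> be a pointwise bounded
  norming family of \<open>1\<close>-Lipschitz functions on a separable space. Members of \<open>L\<close> are encoded by bit
  sequences, Schoenberg's space-filling curve passes through all bit sequences, and between them
  members of \<open>L\<close> are averaged by multilinear interpolation. No Cantor set has to be extended over
  its gaps this way, and linear identities satisfied by \<open>L\<close> survive. For a metric space \<open>L\<close> consists
  of distance functions, for a Banach space of the functionals in the dual unit ball.
\<close>

section \<open>Norming functionals\<close>

text \<open>
  Homogeneity is required only as an inequality. Rescaling by the inverse factor yields equality,
  and the inequality is what passes directly to infima.
\<close>

definition sublinear :: "('a::real_vector \<Rightarrow> real) \<Rightarrow> bool" where
  "sublinear p \<longleftrightarrow> p 0 = 0 \<and> (\<forall>x y. p (x + y) \<le> p x + p y) \<and> (\<forall>c>0. \<forall>x. p (c *\<^sub>R x) \<le> c * p x)"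

lemma sublinear_scaleR:
  assumes "sublinear p" "c \<ge> 0"
  shows "p (c *\<^sub>R x) = c * p x"
proof (cases "c = 0")
  case True
  then show ?thesis using assms by (simp add: sublinear_def)
next
  case False
  then have c: "c > 0" using assms by simp
  have "p ((1/c) *\<^sub>R (c *\<^sub>R x)) \<le> (1/c) * p (c *\<^sub>R x)"
    using assms(1) c unfolding sublinear_def by (metis zero_less_divide_1_iff)
  then have "c * p x \<le> p (c *\<^sub>R x)"
    using c by (simp add: field_simps)
  moreover have "p (c *\<^sub>R x) \<le> c * p x"
    using assms(1) c unfolding sublinear_def by blast
  ultimately show ?thesis by simp
qed

lemma sublinear_ge_neg:
  assumes "sublinear p"
  shows "- p (- x) \<le> p x"
proof -
  have "p (x + - x) \<le> p x + p (- x)" "p 0 = 0"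
    using assms unfolding sublinear_def by blast+
  then show ?thesis by simp
qed

text \<open>
  The infimum of \<open>p (x + t y) - t p y\<close> over \<open>t \<ge> 0\<close> is a sublinear perturbation of \<open>p\<close> that is
  as small as possible at \<open>-y\<close>: any linear functional below it takes the value \<open>p y\<close> at \<open>y\<close>.
  It serves twice, to prescribe a value and to show that minimal sublinear functionals are additive.
\<close>

lemma sublinear_tilt:
  fixes p :: "'a::real_vector \<Rightarrow> real"
  assumes p: "sublinear p"
  obtains q where "sublinear q" "q \<le> p" "\<And>x. q x \<le> p (x + y) - p y"
proof -
  define F where "F x t = p (x + t *\<^sub>R y) - t * p y" for x t
  define q where "q x = (INF t\<in>{0..}. F x t)" for x
  have sub: "p (a + b) \<le> p a + p b" for a b
    using p by (simp add: sublinear_def)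
  have low: "- p (- x) \<le> F x t" if "t \<ge> 0" for x t
  proof -
    have "t * p y = p ((x + t *\<^sub>R y) + - x)"
      using sublinear_scaleR[OF p that] by simp
    also have "\<dots> \<le> p (x + t *\<^sub>R y) + p (- x)"
      by (rule sub)
    finally show ?thesis by (simp add: F_def)
  qed
  then have bdd: "bdd_below (F x ` {0..})" for x
    by (intro bdd_belowI2[of _ "- p (- x)"]) auto
  have qle: "q x \<le> F x t" if "t \<ge> 0" for x t
    unfolding q_def using bdd that by (intro cINF_lower) auto
  have qge: "c \<le> q x" if "\<And>t. t \<ge> 0 \<Longrightarrow> c \<le> F x t" for c x
    unfolding q_def using that by (intro cINF_greatest) auto
  have p0: "p 0 = 0"
    using p by (simp add: sublinear_def)
  have "q 0 = 0"
    using qle[of 0 0] qge[of 0 0] low[of _ 0] p0 by (force simp: F_def)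
  moreover have "q (x + x') \<le> q x + q x'" for x x'
  proof -
    have "q (x + x') - F x t \<le> q x'" if t: "t \<ge> 0" for t
    proof (rule qge)
      fix t' :: real assume t': "t' \<ge> 0"
      have "F (x + x') (t + t') \<le> F x t + F x' t'"
        using sub[of "x + t *\<^sub>R y" "x' + t' *\<^sub>R y"] by (simp add: F_def algebra_simps)
      then show "q (x + x') - F x t \<le> F x' t'"
        using qle[of "t + t'" "x + x'"] t t' by simp
    qed
    then have "q (x + x') - q x' \<le> q x"
      by (intro qge) (simp add: algebra_simps)
    then show ?thesis by simp
  qed
  moreover have "q (c *\<^sub>R x) \<le> c * q x" if c: "c > 0" for c x
  proof -
    have "q (c *\<^sub>R x) / c \<le> q x"
    proof (rule qge)
      fix t :: real assume t: "t \<ge> 0"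
      have "F (c *\<^sub>R x) (c * t) = c * F x t"
        using sublinear_scaleR[OF p, of c "x + t *\<^sub>R y"] c
        by (simp add: F_def algebra_simps)
      then show "q (c *\<^sub>R x) / c \<le> F x t"
        using qle[of "c * t" "c *\<^sub>R x"] t c by (simp add: field_simps)
    qed
    then show ?thesis using c by (simp add: field_simps)
  qed
  ultimately have "sublinear q"
    by (simp add: sublinear_def)
  moreover have "q \<le> p"
    using qle[of 0] by (auto simp: le_fun_def F_def)
  moreover have "q x \<le> p (x + y) - p y" for x
    using qle[of 1 x] by (simp add: F_def)
  ultimately show ?thesis
    using that by (auto simp: le_fun_def)
qed

text \<open>
  Zorn's lemma for the reversed pointwise order. A chain has its pointwise infimum as a lower
  bound, which is finite because \<open>q x \<ge> - q (- x) \<ge> - p (- x)\<close> for every member \<open>q\<close>.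
\<close>

lemma minimal_sublinear_exists:
  fixes p :: "'a::real_vector \<Rightarrow> real"
  assumes p: "sublinear p"
  obtains q where "sublinear q" "q \<le> p" "\<And>r. sublinear r \<Longrightarrow> r \<le> q \<Longrightarrow> r = q"
proof -
  define A where "A = {q. sublinear q \<and> q \<le> p}"
  have "\<exists>m\<in>A. \<forall>a\<in>A. m \<ge> a \<longrightarrow> a = m"
  proof (rule predicate_Zorn)
    show "partial_order_on A (relation_of (\<ge>) A)"
      by (rule partial_order_on_relation_ofI) auto
  next
    fix C assume C: "C \<in> Chains (relation_of (\<ge>) A)"
    show "\<exists>u\<in>A. \<forall>a\<in>C. u \<le> a"
    proof (cases "C = {}")
      case True
      then show ?thesis using p by (auto simp: A_def)
    next
      case False
      have CA: "q \<in> A" if "q \<in> C" for q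
        using C that unfolding Chains_def relation_of_def by auto
      have tot: "q \<le> q' \<or> q' \<le> q" if "q \<in> C" "q' \<in> C" for q q'
        using C that unfolding Chains_def relation_of_def by auto
      have subq: "sublinear q" and leq: "q x \<le> p x" if "q \<in> C" for q x
        using CA[OF that] by (auto simp: A_def le_fun_def)
      have "- p (- x) \<le> q x" if "q \<in> C" for q x
        using sublinear_ge_neg[OF subq[OF that], of x] leq[OF that, of "- x"] by linarith
      then have bdd: "bdd_below ((\<lambda>q. q x) ` C)" for x
        by (intro bdd_belowI2) auto
      define u where "u x = (INF q\<in>C. q x)" for x
      have ule: "u x \<le> q x" if "q \<in> C" for q x
        unfolding u_def using that bdd by (intro cINF_lower) auto
      have uge: "c \<le> u x" if "\<And>q. q \<in> C \<Longrightarrow> c \<le> q x" for c x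
        unfolding u_def using that False by (intro cINF_greatest) auto
      have "u 0 = 0"
      proof -
        have "(\<lambda>q. q 0) ` C = {0}"
          using subq False by (force simp: sublinear_def)
        then show ?thesis by (simp add: u_def)
      qed
      moreover have "u (x + y) \<le> u x + u y" for x y
      proof -
        have "u (x + y) - q x \<le> u y" if q: "q \<in> C" for q
        proof (rule uge)
          fix q' assume q': "q' \<in> C"
          obtain r where r: "r \<in> C" "r \<le> q" "r \<le> q'"
            using tot[OF q q'] q q' by auto
          have "u (x + y) \<le> r (x + y)"
            using ule r by blast
          also have "\<dots> \<le> r x + r y"
            using subq[OF r(1)] by (simp add: sublinear_def)
          also have "\<dots> \<le> q x + q' y"
            using r by (intro add_mono) (auto simp: le_fun_def)
          finally show "u (x + y) - q x \<le> q' y" by simp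
        qed
        then have "u (x + y) - u y \<le> u x"
          by (intro uge) (simp add: algebra_simps)
        then show ?thesis by simp
      qed
      moreover have "u (c *\<^sub>R x) \<le> c * u x" if c: "c > 0" for c x
      proof -
        have "u (c *\<^sub>R x) / c \<le> u x"
        proof (rule uge)
          fix q assume q: "q \<in> C"
          have "u (c *\<^sub>R x) \<le> c * q x"
            using ule[OF q, of "c *\<^sub>R x"] sublinear_scaleR[OF subq[OF q], of c x] c by simp
          then show "u (c *\<^sub>R x) / c \<le> q x"
            using c by (simp add: field_simps)
        qed
        then show ?thesis using c by (simp add: field_simps)
      qed
      ultimately have "sublinear u"
        by (simp add: sublinear_def)
      moreover have "u \<le> p"
        using False ule leq unfolding le_fun_def by (meson all_not_in_conv order_trans)
      ultimately show ?thesis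
        using ule by (auto simp: A_def le_fun_def)
    qed
  qed
  then obtain q where q: "q \<in> A" "\<And>r. r \<in> A \<Longrightarrow> r \<le> q \<Longrightarrow> r = q"
    by auto
  show ?thesis
    by (rule that[of q]) (use q in \<open>auto simp: A_def intro: order_trans\<close>)
qed

text \<open>
  Tilting a minimal functional in direction \<open>y\<close> cannot change it, and then the bound of the tilted
  functional is the missing half of additivity. Working with minimal elements avoids the one-dimensional
  extension step of the usual Hahn-Banach argument, and with it partially defined functionals.
\<close>

lemma minimal_sublinear_linear:
  assumes q: "sublinear q" and min: "\<And>r. sublinear r \<Longrightarrow> r \<le> q \<Longrightarrow> r = q"
  shows "linear q"
proof -
  have add: "q (x + y) = q x + q y" for x y
  proof -
    obtain r where r: "sublinear r" "r \<le> q" "\<And>x. r x \<le> q (x + y) - q y"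
      using sublinear_tilt[OF q, of y] by metis
    then have "q x \<le> q (x + y) - q y"
      using min by metis
    moreover have "q (x + y) \<le> q x + q y"
      using q by (simp add: sublinear_def)
    ultimately show ?thesis by simp
  qed
  have neg: "q (- x) = - q x" for x
    using add[of x "- x"] q by (simp add: sublinear_def)
  have "q (c *\<^sub>R x) = c * q x" for c x
  proof (cases "c \<ge> 0")
    case True
    then show ?thesis by (rule sublinear_scaleR[OF q])
  next
    case False
    then have "q ((- c) *\<^sub>R x) = - c * q x"
      by (intro sublinear_scaleR[OF q]) auto
    then show ?thesis using neg[of "c *\<^sub>R x"] by simp
  qed
  with add show ?thesis
    by (intro linearI) auto
qed

text \<open>
  The norm is tilted in direction \<open>y\<close> before passing to a minimal functional, which forces the
  value at \<open>y\<close>.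
\<close>

theorem norming_functional_exists:
  fixes y :: "'a::real_normed_vector"
  obtains f :: "'a \<Rightarrow> real" where "linear f" "\<And>x. \<bar>f x\<bar> \<le> norm x" "f y = norm y"
proof -
  have n: "sublinear (norm :: 'a \<Rightarrow> real)"
    by (simp add: sublinear_def norm_triangle_ineq)
  obtain p where p: "sublinear p" "p \<le> norm" "\<And>x. p x \<le> norm (x + y) - norm y"
    using sublinear_tilt[OF n, of y] by metis
  obtain f where f: "sublinear f" "f \<le> p" "\<And>r. sublinear r \<Longrightarrow> r \<le> f \<Longrightarrow> r = f"
    using minimal_sublinear_exists[OF p(1)] by metis
  have lin: "linear f"
    using f by (intro minimal_sublinear_linear) auto
  have le: "f x \<le> norm x" for x
    using f(2) p(2) by (auto simp: le_fun_def intro: order_trans)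
  have "f (- y) \<le> - norm y"
    using f(2) p(3)[of "- y"] by (auto simp: le_fun_def intro: order_trans)
  then have "f y = norm y"
    using le[of y] linear_neg[OF lin, of y] by simp
  moreover have "\<bar>f x\<bar> \<le> norm x" for x
    using le[of x] le[of "- x"] linear_neg[OF lin, of x] by simp
  ultimately show ?thesis using that lin by blast
qed

section \<open>A curve through all bit sequences\<close>

text \<open>
  The expectation of \<open>G A\<close> for a random set \<open>A\<close> that contains each \<open>k < i\<close> independently with
  probability \<open>s k\<close>. It is the multilinear extension of \<open>G\<close> from the vertices of the cube
  \<open>{0,1}\<^sup>i\<close>, a subset of \<open>{..<i}\<close> being a vertex.
\<close>

primrec multilinear :: "(nat \<Rightarrow> real) \<Rightarrow> nat \<Rightarrow> (nat set \<Rightarrow> real) \<Rightarrow> real" where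
  "multilinear s 0 G = G {}"
| "multilinear s (Suc i) G = multilinear s i (\<lambda>A. (1 - s i) * G A + s i * G (insert i A))"

lemma multilinear_linear: "multilinear s i (\<lambda>A. a * G A + b * H A) = a * multilinear s i G + b * multilinear s i H"
proof (induction i arbitrary: G H)
  case (Suc i)
  have "multilinear s (Suc i) (\<lambda>A. a * G A + b * H A) =
    multilinear s i (\<lambda>A. a * ((1 - s i) * G A + s i * G (insert i A)) + b * ((1 - s i) * H A + s i * H (insert i A)))"
    by (simp add: algebra_simps)
  then show ?case
    by (simp only: Suc multilinear.simps)
qed simp

lemma multilinear_diff: "multilinear s i (\<lambda>A. G A - H A) = multilinear s i G - multilinear s i H"
  using multilinear_linear[of s i 1 G "-1" H] by simp

lemma abs_multilinear_le:
  assumes "\<And>k. 0 \<le> s k" "\<And>k. s k \<le> 1" "\<And>A. \<bar>G A\<bar> \<le> B"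
  shows "\<bar>multilinear s i G\<bar> \<le> B"
  using assms(3)
proof (induction i arbitrary: G)
  case (Suc i)
  have "\<bar>(1 - s i) * G A + s i * G (insert i A)\<bar> \<le> B" for A
  proof -
    have "\<bar>(1 - s i) * G A + s i * G (insert i A)\<bar> \<le> (1 - s i) * \<bar>G A\<bar> + s i * \<bar>G (insert i A)\<bar>"
      using assms(1,2)[of i] by (intro order_trans[OF abs_triangle_ineq]) (simp add: abs_mult)
    also have "\<dots> \<le> (1 - s i) * B + s i * B"
      using assms(1,2)[of i] Suc.prems by (intro add_mono mult_left_mono) auto
    finally show ?thesis by (simp add: algebra_simps)
  qed
  then show ?case by (simp add: Suc.IH)
qed simp

lemma continuous_on_multilinear:
  assumes "\<And>k. continuous_on X (\<lambda>t. s t k)" "\<And>A. continuous_on X (\<lambda>t. G t A)"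
  shows "continuous_on X (\<lambda>t. multilinear (s t) i (G t))"
  using assms(2)
proof (induction i arbitrary: G)
  case (Suc i)
  show ?case
    by (simp, rule Suc.IH) (intro continuous_intros assms Suc.prems)
qed simp

lemma multilinear_bits:
  assumes "\<And>k. k < i \<Longrightarrow> s k = (if k \<in> A then 1 else 0)"
  shows "multilinear s i G = G (A \<inter> {..<i})"
  using assms
proof (induction i arbitrary: G)
  case (Suc i)
  have "A \<inter> {..<Suc i} = (if i \<in> A then insert i (A \<inter> {..<i}) else A \<inter> {..<i})"
    by (auto simp: less_Suc_eq)
  then show ?case using Suc by auto
qed simp

lemma multilinear_stable:
  assumes "i \<le> j" and G: "\<And>A B. A \<inter> {..<i} = B \<inter> {..<i} \<Longrightarrow> G A = G B"
  shows "multilinear s j G = multilinear s i G"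
  using assms(1)
proof (induction j rule: dec_induct)
  case (step j)
  have "G (insert j A) = G A" for A
    using step(1) by (intro G) auto
  then have "multilinear s (Suc j) G = multilinear s j (\<lambda>A. (1 - s j) * G A + s j * G A)"
    by simp
  also have "\<dots> = multilinear s j G"
    by (simp add: left_diff_distrib)
  finally show ?case using step by simp
qed simp

text \<open>
  Schoenberg's construction: a continuous function of \<open>u = 3\<^sup>k t\<close> with period \<open>2\<close> that is \<open>0\<close> on
  \<open>[0, 1/3]\<close> and \<open>1\<close> on \<open>[2/3, 1]\<close>, and so reads off the ternary digits of the points of the Cantor set.
  The truncated cosine is periodic and continuous by construction.
\<close>

definition schoenberg_bit :: "nat \<Rightarrow> real \<Rightarrow> real" where
  "schoenberg_bit k t = max 0 (min 1 (1/2 - cos (pi * (3 ^ k * t))))"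

lemma schoenberg_bit_bounds: "0 \<le> schoenberg_bit k t" "schoenberg_bit k t \<le> 1"
  by (auto simp: schoenberg_bit_def)

lemma continuous_on_schoenberg_bit: "continuous_on X (schoenberg_bit k)"
  unfolding schoenberg_bit_def by (intro continuous_intros)

text \<open>
  The point is \<open>\<Sum>\<^sub>j 2 b\<^sub>j / 3\<^bsup>j+1\<^esup>\<close> for the prescribed bits \<open>b\<close>. Multiplying by \<open>3\<^sup>k\<close> splits off an even
  integer, which the period absorbs, and leaves the same series for the shifted bits, whose position
  in \<open>[0,1]\<close> is governed by \<open>b\<^sub>k\<close>.
\<close>

lemma schoenberg_bits_realize:
  obtains t where "t \<in> {0..1}" "\<And>k. schoenberg_bit k t = (if k \<in> A then 1 else 0)"
proof -
  define T where "T c = (\<Sum>j. 2 * c j / 3 ^ Suc j)" for c :: "nat \<Rightarrow> real"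
  define c where "c k j = (if j + k \<in> A then 1 else 0 :: real)" for k j
  have geo: "(\<lambda>j. 2 / 3 ^ Suc j :: real) sums 1"
    using sums_mult[OF geometric_sums[of "1/3 :: real"], of "2/3"] by (simp add: power_divide)
  have sm: "summable (\<lambda>j. 2 * c k j / 3 ^ Suc j)" for k
    by (rule summable_comparison_test'[OF sums_summable[OF geo], of 0]) (auto simp: c_def)
  have T: "T (c k) \<in> {0..1}" for k
  proof -
    have "0 \<le> T (c k)"
      unfolding T_def by (intro suminf_nonneg sm) (auto simp: c_def)
    moreover have "T (c k) \<le> (\<Sum>j. 2 / 3 ^ Suc j)"
      unfolding T_def by (intro suminf_le sm sums_summable[OF geo]) (auto simp: c_def)
    ultimately show ?thesis using sums_unique[OF geo] by simp
  qed
  have shift: "T (c k) = 2 * c k 0 / 3 + T (c (Suc k)) / 3" for k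
  proof -
    have "T (c k) = (\<Sum>j. 2 * c k (Suc j) / 3 ^ Suc (Suc j)) + 2 * c k 0 / 3"
      unfolding T_def using suminf_split_head[OF sm[of k]] by simp
    also have "(\<Sum>j. 2 * c k (Suc j) / 3 ^ Suc (Suc j)) = (\<Sum>j. (2 * c (Suc k) j / 3 ^ Suc j) / 3)"
      by (simp add: c_def)
    also have "\<dots> = T (c (Suc k)) / 3"
      unfolding T_def by (rule suminf_divide[OF sm])
    finally show ?thesis by simp
  qed
  have exp: "\<exists>m::nat. 3 ^ k * T (c 0) = 2 * real m + T (c k)" for k
  proof (induction k)
    case (Suc k)
    then obtain m where "3 ^ k * T (c 0) = 2 * real m + T (c k)" by blast
    then have "3 ^ Suc k * T (c 0) = 6 * real m + 3 * T (c k)" by simp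
    also have "\<dots> = 2 * real (3 * m + (if k \<in> A then 1 else 0)) + T (c (Suc k))"
      using shift[of k] by (simp add: c_def)
    finally show ?case by blast
  qed (auto intro: exI[of _ 0])
  have "schoenberg_bit k (T (c 0)) = (if k \<in> A then 1 else 0)" for k
  proof -
    obtain m where "3 ^ k * T (c 0) = 2 * real m + T (c k)"
      using exp by blast
    then have "pi * (3 ^ k * T (c 0)) = pi * T (c k) + 2 * real m * pi"
      by (simp add: algebra_simps)
    then have cs: "cos (pi * (3 ^ k * T (c 0))) = cos (pi * T (c k))"
      by (simp only: cos_add cos_2npi sin_2npi)
    show ?thesis
    proof (cases "k \<in> A")
      case True
      then have "T (c k) \<ge> 2/3"
        using shift[of k] T[of "Suc k"] by (simp add: c_def)
      then have "cos (pi * T (c k)) \<le> cos (pi - pi / 3)"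
        using T[of k] by (intro cos_monotone_0_pi_le) (auto simp: field_simps)
      then show ?thesis
        using True cs cos_pi_minus[of "pi / 3"] by (simp add: schoenberg_bit_def cos_60)
    next
      case False
      then have "T (c k) \<le> 1/3"
        using shift[of k] T[of "Suc k"] by (simp add: c_def)
      then have "cos (pi / 3) \<le> cos (pi * T (c k))"
        using T[of k] by (intro cos_monotone_0_pi_le) (auto simp: field_simps)
      then show ?thesis
        using False cs by (simp add: schoenberg_bit_def cos_60)
    qed
  qed
  with T[of 0] that show ?thesis by blast
qed

section \<open>Separable spaces inside \<open>C([0,1])\<close>\<close>

text \<open>
  A real sequence is encoded by comparing each of its terms with each rational number.
\<close>

definition threshold_bit :: "(nat \<Rightarrow> real) \<Rightarrow> nat \<Rightarrow> bool" where
  "threshold_bit v i = (case from_nat i :: nat \<times> rat of (n, q) \<Rightarrow> real_of_rat q < v n)"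

text \<open>
  Comparing a bounded number with the finitely many multiples of a small rational \<open>\<delta>\<close> in its range
  locates it up to \<open>\<delta>\<close>, and these finitely many comparisons have bounded codes.
\<close>

lemma threshold_bits_determine:
  assumes "\<epsilon> > 0"
  obtains N where "\<And>v w. \<bar>v n\<bar> \<le> R \<Longrightarrow> \<bar>w n\<bar> \<le> R \<Longrightarrow>
     (\<And>i. i < N \<Longrightarrow> threshold_bit v i = threshold_bit w i) \<Longrightarrow> \<bar>v n - w n\<bar> \<le> \<epsilon>"
proof -
  obtain \<delta> :: rat where \<delta>: "0 < real_of_rat \<delta>" "real_of_rat \<delta> < \<epsilon>"
    using of_rat_dense[OF assms] by blast
  define K where "K = \<lceil>R / of_rat \<delta>\<rceil>"
  define code where "code k = to_nat (n, of_int k * \<delta>)" for k :: int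
  define N where "N = Suc (Max (code ` {-K..K+1}))"
  have half: "v n - w n \<le> \<epsilon>"
    if v: "\<bar>v n\<bar> \<le> R" and w: "\<bar>w n\<bar> \<le> R" and eq: "\<And>i. i < N \<Longrightarrow> threshold_bit v i = threshold_bit w i" for v w
  proof (rule ccontr)
    assume "\<not> ?thesis"
    then have far: "w n + of_rat \<delta> < v n" using \<delta> by simp
    define k where "k = \<lceil>w n / of_rat \<delta>\<rceil>"
    have k1: "w n / of_rat \<delta> \<le> of_int k" "of_int k < w n / of_rat \<delta> + 1"
      unfolding k_def by linarith+
    have "- (R / of_rat \<delta>) \<le> w n / of_rat \<delta>" "w n / of_rat \<delta> \<le> R / of_rat \<delta>"
      using w \<delta> by (auto simp: field_simps)
    then have "k \<in> {-K..K+1}"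
      unfolding k_def K_def by (auto simp: ceiling_le_iff) linarith+
    then have "code k < N"
      unfolding N_def by (intro le_imp_less_Suc Max_ge) auto
    then have "threshold_bit v (code k) = threshold_bit w (code k)"
      by (rule eq)
    then have "of_int k * real_of_rat \<delta> < v n \<longleftrightarrow> of_int k * real_of_rat \<delta> < w n"
      by (simp add: threshold_bit_def code_def of_rat_mult)
    moreover have "w n \<le> of_int k * of_rat \<delta>" "of_int k * of_rat \<delta> < w n + of_rat \<delta>"
      using k1 \<delta> by (simp_all add: field_simps)
    ultimately show False using far by linarith
  qed
  show ?thesis
  proof (rule that[of N])
    fix v w :: "nat \<Rightarrow> real"
    assume *: "\<bar>v n\<bar> \<le> R" "\<bar>w n\<bar> \<le> R" "\<And>i. i < N \<Longrightarrow> threshold_bit v i = threshold_bit w i"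
    show "\<bar>v n - w n\<bar> \<le> \<epsilon>"
      using half[OF *] half[OF *(2,1) *(3)[symmetric]] by (simp add: abs_le_iff)
  qed
qed

text \<open>
  The branch selects members of \<open>L\<close> whose bits follow a prescribed set \<open>A\<close> as long as possible. When
  no member of \<open>L\<close> has the next prescribed bit in addition to the bits already fixed, the current
  member is kept, so that the branch never leaves \<open>L\<close>. Bits that have been fixed do not change any
  more, so the values along a branch converge for every \<open>A\<close>, whether or not \<open>A\<close> is the code of a
  member of \<open>L\<close>.
\<close>

definition continues :: "'f set \<Rightarrow> ('f \<Rightarrow> nat \<Rightarrow> bool) \<Rightarrow> nat set \<Rightarrow> nat \<Rightarrow> 'f \<Rightarrow> 'f \<Rightarrow> bool" where
  "continues L \<beta> A i g l \<longleftrightarrow> l \<in> L \<and> (\<forall>k<i. \<beta> l k = \<beta> g k) \<and> \<beta> l i = (i \<in> A)"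

primrec branch :: "'f set \<Rightarrow> ('f \<Rightarrow> nat \<Rightarrow> bool) \<Rightarrow> nat set \<Rightarrow> nat \<Rightarrow> 'f" where
  "branch L \<beta> A 0 = (SOME l. l \<in> L)"
| "branch L \<beta> A (Suc i) =
    (if Ex (continues L \<beta> A i (branch L \<beta> A i))
     then SOME l. continues L \<beta> A i (branch L \<beta> A i) l
     else branch L \<beta> A i)"

lemma branch_step:
  "continues L \<beta> A i (branch L \<beta> A i) (branch L \<beta> A (Suc i)) \<or>
   (\<nexists>l. continues L \<beta> A i (branch L \<beta> A i) l) \<and> branch L \<beta> A (Suc i) = branch L \<beta> A i"
  by (auto intro: someI)

lemma branch_in: "L \<noteq> {} \<Longrightarrow> branch L \<beta> A i \<in> L"
proof (induction i)
  case 0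
  then show ?case by (simp add: some_in_eq)
next
  case (Suc i)
  then show ?case using branch_step[of L \<beta> A i] by (auto simp: continues_def simp del: branch.simps)
qed

lemma branch_extends: "i \<le> j \<Longrightarrow> k < i \<Longrightarrow> \<beta> (branch L \<beta> A j) k = \<beta> (branch L \<beta> A i) k"
proof (induction j rule: dec_induct)
  case (step j)
  then show ?case using branch_step[of L \<beta> A j] by (auto simp: continues_def simp del: branch.simps)
qed simp

lemma branch_cong: "A \<inter> {..<i} = B \<inter> {..<i} \<Longrightarrow> branch L \<beta> A i = branch L \<beta> B i"
proof (induction i)
  case (Suc i)
  have "A \<inter> {..<i} = B \<inter> {..<i}" "i \<in> A \<longleftrightarrow> i \<in> B"
    using Suc.prems by (auto simp: set_eq_iff less_Suc_eq)
  then have "continues L \<beta> A i g = continues L \<beta> B i g" for g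
    by (simp add: continues_def fun_eq_iff)
  with Suc.IH \<open>A \<inter> {..<i} = B \<inter> {..<i}\<close> show ?case by auto
qed simp

lemma branch_follows:
  assumes "l \<in> L"
  shows "k < i \<Longrightarrow> \<beta> (branch L \<beta> {k. \<beta> l k} i) k = \<beta> l k"
proof (induction i arbitrary: k)
  case (Suc i)
  then show ?case
    using branch_step[of L \<beta> "{k. \<beta> l k}" i] assms
    by (auto simp: less_Suc_eq continues_def simp del: branch.simps)
qed simp

text \<open>
  \<open>J x t\<close> is the limit of the multilinear interpolations of the values at \<open>x\<close> of the branches, taken at
  the Schoenberg bits of \<open>t\<close>. The convergence is uniform in \<open>t\<close>, since finitely many bits determine the
  value at \<open>x\<close> up to any given error. This gives continuity. Averages of differences bounded by the
  distance stay bounded by it, and where the Schoenberg bits are the code of some \<open>l \<in> L\<close> the limit is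
  \<open>l x\<close>, so a norming \<open>l\<close> attains the distance. The last property records that \<open>J\<close> inherits every
  linear relation that holds throughout \<open>L\<close>.
\<close>

theorem universal_C01:
  fixes m :: "'m metric" and L :: "('m \<Rightarrow> real) set"
  assumes sep: "separable_space (mtopology_of m)" and ne: "mspace m \<noteq> {}"
    and lip: "\<And>l x y. \<lbrakk>l \<in> L; x \<in> mspace m; y \<in> mspace m\<rbrakk> \<Longrightarrow> \<bar>l x - l y\<bar> \<le> mdist m x y"
    and bdd: "\<And>x. x \<in> mspace m \<Longrightarrow> \<exists>R. \<forall>l\<in>L. \<bar>l x\<bar> \<le> R"
    and norming: "\<And>x y. \<lbrakk>x \<in> mspace m; y \<in> mspace m\<rbrakk> \<Longrightarrow> \<exists>l\<in>L. \<bar>l x - l y\<bar> = mdist m x y"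
  obtains J :: "'m \<Rightarrow> real \<Rightarrow> real" where
    "\<And>x. x \<in> mspace m \<Longrightarrow> continuous_on {0..1} (J x)"
    "\<And>x y t. \<lbrakk>x \<in> mspace m; y \<in> mspace m; t \<in> {0..1}\<rbrakk> \<Longrightarrow> \<bar>J x t - J y t\<bar> \<le> mdist m x y"
    "\<And>x y. \<lbrakk>x \<in> mspace m; y \<in> mspace m\<rbrakk> \<Longrightarrow> \<exists>t\<in>{0..1}. \<bar>J x t - J y t\<bar> = mdist m x y"
    "\<And>x y z a b t. \<lbrakk>x \<in> mspace m; y \<in> mspace m; z \<in> mspace m; t \<in> {0..1};
        \<And>l. l \<in> L \<Longrightarrow> l z = a * l x + b * l y\<rbrakk> \<Longrightarrow> J z t = a * J x t + b * J y t"
proof -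
  interpret Metric_space "mspace m" "mdist m"
    by simp
  have mt: "mtopology_of m = mtopology"
    by (simp add: mtopology_of_def)
  obtain C where C: "countable C" "C \<subseteq> mspace m" "mtopology closure_of C = mspace m"
    using sep unfolding separable_space_def mt by (auto simp: topspace_mtopology)
  then have "C \<noteq> {}" using ne by auto
  define d where "d = from_nat_into C"
  have dM: "d n \<in> mspace m" for n
    using C \<open>C \<noteq> {}\<close> from_nat_into[of C n] by (auto simp: d_def)
  have dense: "\<exists>n. mdist m x (d n) < e" if "x \<in> mspace m" "e > 0" for x e
  proof -
    have "x \<in> mtopology closure_of C" using C that by simp
    then obtain y where "y \<in> C" "y \<in> mball x e"
      using \<open>e > 0\<close> by (auto simp: metric_closure_of)
    then show ?thesis
      using from_nat_into_surj[OF C(1), of y] by (auto simp: d_def)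
  qed
  obtain x0 where "x0 \<in> mspace m" using ne by blast
  then have Lne: "L \<noteq> {}" using norming by blast
  define \<beta> where "\<beta> l = threshold_bit (\<lambda>n. l (d n))" for l
  \<comment> \<open>Finitely many bits control the value at some \<open>d n\<close> near \<open>x\<close>, hence, by the Lipschitz
      property, the value at \<open>x\<close>.\<close>
  have close: "\<exists>N. \<forall>l\<in>L. \<forall>l'\<in>L. (\<forall>k<N. \<beta> l k = \<beta> l' k) \<longrightarrow> \<bar>l x - l' x\<bar> \<le> e"
    if x: "x \<in> mspace m" and e: "e > 0" for x e
  proof -
    obtain n where n: "mdist m x (d n) < e / 3"
      using dense[OF x, of "e/3"] e by auto
    obtain R where R: "\<And>l. l \<in> L \<Longrightarrow> \<bar>l (d n)\<bar> \<le> R"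
      using bdd[OF dM] by blast
    obtain N where N: "\<And>v w. \<bar>v n\<bar> \<le> R \<Longrightarrow> \<bar>w n\<bar> \<le> R \<Longrightarrow>
     (\<And>i. i < N \<Longrightarrow> threshold_bit v i = threshold_bit w i) \<Longrightarrow> \<bar>v n - w n\<bar> \<le> e / 3"
      using threshold_bits_determine[of "e/3" n R] e by auto
    show ?thesis
    proof (intro exI ballI impI)
      fix l l' assume l: "l \<in> L" "l' \<in> L" and "\<forall>k<N. \<beta> l k = \<beta> l' k"
      then have "\<bar>l (d n) - l' (d n)\<bar> \<le> e / 3"
        using N[of "\<lambda>n. l (d n)" "\<lambda>n. l' (d n)"] R by (auto simp: \<beta>_def)
      then show "\<bar>l x - l' x\<bar> \<le> e"
        using lip[OF l(1) x dM, of n] lip[OF l(2) x dM, of n] n by linarith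
    qed
  qed
  define s where "s t k = schoenberg_bit k t" for t k
  define E where "E i x t = multilinear (s t) i (\<lambda>A. branch L \<beta> A i x)" for i x t
  define J where "J x t = lim (\<lambda>i. E i x t)" for x t
  have ul: "uniform_limit {0..1} (\<lambda>i. E i x) (J x) sequentially" if x: "x \<in> mspace m" for x
  proof -
    have "uniformly_Cauchy_on {0..1} (\<lambda>i. E i x)"
      unfolding uniformly_Cauchy_on_def
    proof (intro allI impI)
      fix e :: real assume "e > 0"
      then obtain N where N: "\<And>l l'. l \<in> L \<Longrightarrow> l' \<in> L \<Longrightarrow> (\<forall>k<N. \<beta> l k = \<beta> l' k) \<Longrightarrow> \<bar>l x - l' x\<bar> \<le> e / 3"
        using close[OF x, of "e/3"] by auto
      have near: "\<bar>E i x t - E N x t\<bar> \<le> e / 3" if "i \<ge> N" for i t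
      proof -
        have "E N x t = multilinear (s t) i (\<lambda>A. branch L \<beta> A N x)"
          unfolding E_def by (rule multilinear_stable[symmetric, OF that]) (metis branch_cong)
        then have "E i x t - E N x t = multilinear (s t) i (\<lambda>A. branch L \<beta> A i x - branch L \<beta> A N x)"
          by (simp add: E_def multilinear_diff)
        also have "\<bar>\<dots>\<bar> \<le> e / 3"
          using that by (intro abs_multilinear_le N branch_in Lne) (auto simp: s_def schoenberg_bit_bounds branch_extends)
        finally show ?thesis .
      qed
      show "\<exists>M. \<forall>t\<in>{0..1}. \<forall>i\<ge>M. \<forall>j\<ge>M. dist (E i x t) (E j x t) < e"
      proof (intro exI[of _ N] ballI allI impI)
        fix t i j assume "N \<le> i" "N \<le> j"
        then show "dist (E i x t) (E j x t) < e"
          using near[of i t] near[of j t] \<open>e > 0\<close> unfolding dist_real_def by linarith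
      qed
    qed
    then have "uniformly_convergent_on {0..1} (\<lambda>i. E i x)"
      by (rule Cauchy_uniformly_convergent)
    then show ?thesis
      unfolding J_def by (simp add: uniformly_convergent_uniform_limit_iff)
  qed
  have pl: "(\<lambda>i. E i x t) \<longlonglongrightarrow> J x t" if "x \<in> mspace m" "t \<in> {0..1}" for x t
    using tendsto_uniform_limitI[OF ul] that by blast
  show ?thesis
  proof (rule that[of J])
    show "continuous_on {0..1} (J x)" if "x \<in> mspace m" for x
    proof (rule uniform_limit_theorem[OF _ ul[OF that]])
      show "\<forall>\<^sub>F i in sequentially. continuous_on {0..1} (E i x)"
        unfolding E_def s_def
        by (intro always_eventually allI continuous_on_multilinear continuous_on_schoenberg_bit continuous_on_const)
    qed simp
  next
    fix x y t assume xy: "x \<in> mspace m" "y \<in> mspace m" "t \<in> {0..(1::real)}"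
    have "\<bar>E i x t - E i y t\<bar> \<le> mdist m x y" for i
      unfolding E_def multilinear_diff[symmetric]
      by (intro abs_multilinear_le lip branch_in Lne xy) (auto simp: s_def schoenberg_bit_bounds)
    then show "\<bar>J x t - J y t\<bar> \<le> mdist m x y"
      by (intro tendsto_upperbound[OF tendsto_rabs[OF tendsto_diff[OF pl pl]]] xy) auto
  next
    fix x y assume xy: "x \<in> mspace m" "y \<in> mspace m"
    then obtain l where l: "l \<in> L" "\<bar>l x - l y\<bar> = mdist m x y"
      using norming by blast
    obtain t where t: "t \<in> {0..1}" "\<And>k. s t k = (if k \<in> {k. \<beta> l k} then 1 else 0)"
      using schoenberg_bits_realize[of "{k. \<beta> l k}"] unfolding s_def by auto
    \<comment> \<open>At this \<open>t\<close> the interpolation is a vertex value, and the branch along the code of \<open>l\<close>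
        agrees with \<open>l\<close> in more and more bits.\<close>
    have Jl: "J z t = l z" if z: "z \<in> mspace m" for z
    proof (rule LIMSEQ_unique[OF pl[OF z t(1)]])
      show "(\<lambda>i. E i z t) \<longlonglongrightarrow> l z"
      proof (rule LIMSEQ_I)
        fix e :: real assume "e > 0"
        then obtain N where N: "\<And>l l'. l \<in> L \<Longrightarrow> l' \<in> L \<Longrightarrow> (\<forall>k<N. \<beta> l k = \<beta> l' k) \<Longrightarrow> \<bar>l z - l' z\<bar> \<le> e / 2"
          using close[OF z, of "e/2"] by auto
        have "norm (E i z t - l z) < e" if "i \<ge> N" for i
        proof -
          have "E i z t = branch L \<beta> ({k. \<beta> l k} \<inter> {..<i}) i z"
            unfolding E_def by (rule multilinear_bits) (use t in auto)
          also have "\<dots> = branch L \<beta> {k. \<beta> l k} i z"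
            by (metis branch_cong inf.right_idem)
          finally have E: "E i z t = branch L \<beta> {k. \<beta> l k} i z" .
          have "\<bar>branch L \<beta> {k. \<beta> l k} i z - l z\<bar> \<le> e / 2"
            using branch_follows[OF l(1), of _ i \<beta>] that by (intro N branch_in Lne l(1)) auto
          then show ?thesis using \<open>e > 0\<close> E by simp
        qed
        then show "\<exists>N. \<forall>i\<ge>N. norm (E i z t - l z) < e" by blast
      qed
    qed
    show "\<exists>t\<in>{0..1}. \<bar>J x t - J y t\<bar> = mdist m x y"
      by (rule bexI[OF _ t(1)]) (simp only: Jl xy l(2))
  next
    fix x y z a b t
    assume xyz: "x \<in> mspace m" "y \<in> mspace m" "z \<in> mspace m" "t \<in> {0..(1::real)}"
      and lin: "\<And>l. l \<in> L \<Longrightarrow> l z = a * l x + b * l y"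
    have "E i z t = a * E i x t + b * E i y t" for i
      unfolding E_def multilinear_linear[symmetric] using lin branch_in[OF Lne] by simp
    then have "(\<lambda>i. E i z t) \<longlonglongrightarrow> a * J x t + b * J y t"
      by (simp only:) (intro tendsto_intros pl xyz)
    then show "J z t = a * J x t + b * J y t"
      by (rule LIMSEQ_unique[OF pl[OF xyz(3,4)]])
  qed
qed

section \<open>Averaging a Lipschitz map over a cube\<close>

text \<open>
  Lipschitz in each coordinate with its own constant. This is all that one-dimensional integrals in
  the separate coordinates need, and each partial average inherits it with the same constants.
\<close>

definition coord_lip :: "(nat \<Rightarrow> real) \<Rightarrow> ((nat \<Rightarrow> real) \<Rightarrow> 'y::real_normed_vector) \<Rightarrow> bool" where
  "coord_lip w g \<longleftrightarrow> (\<forall>\<tau> k s. norm (g (\<tau>(k := s)) - g \<tau>) \<le> w k * \<bar>s - \<tau> k\<bar>)"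

text \<open>
  Averages over \<open>[0,1]\<^sup>n\<close> are built from one-dimensional integrals because the target is an arbitrary,
  possibly nonseparable Banach space and \<open>n\<close> varies. The Henstock-Kurzweil integral covers continuous
  functions of one real variable with values in any Banach space.
\<close>

definition coord_mean :: "nat \<Rightarrow> ((nat \<Rightarrow> real) \<Rightarrow> 'y::banach) \<Rightarrow> (nat \<Rightarrow> real) \<Rightarrow> 'y" where
  "coord_mean k g \<tau> = integral {0..1} (\<lambda>s. g (\<tau>(k := s)))"

primrec cube_mean :: "nat \<Rightarrow> ((nat \<Rightarrow> real) \<Rightarrow> 'y::banach) \<Rightarrow> (nat \<Rightarrow> real) \<Rightarrow> 'y" where
  "cube_mean 0 g = g"
| "cube_mean (Suc n) g = cube_mean n (coord_mean n g)"

lemma coord_lip_upd: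
  assumes "coord_lip w g"
  shows "norm (g (\<tau>(k := s)) - g (\<tau>(k := s'))) \<le> w k * \<bar>s - s'\<bar>"
  using assms[unfolded coord_lip_def, rule_format, of "\<tau>(k := s')" k s] by simp

lemma coord_lip_nonneg:
  assumes "coord_lip w g"
  shows "0 \<le> w k"
proof -
  have "0 \<le> norm (g ((\<lambda>_. 0)(k := 1)) - g (\<lambda>_. 0))"
    by simp
  also have "\<dots> \<le> w k * \<bar>1 - 0\<bar>"
    using assms unfolding coord_lip_def by blast
  finally show ?thesis by simp
qed

lemma coord_lip_add:
  assumes "coord_lip v g" "coord_lip w h"
  shows "coord_lip (\<lambda>k. v k + w k) (\<lambda>\<tau>. g \<tau> + h \<tau>)"
  unfolding coord_lip_def
proof (intro allI)
  fix \<tau> :: "nat \<Rightarrow> real" and k s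
  have "g (\<tau>(k := s)) + h (\<tau>(k := s)) - (g \<tau> + h \<tau>) = (g (\<tau>(k := s)) - g \<tau>) + (h (\<tau>(k := s)) - h \<tau>)"
    by simp
  also have "norm \<dots> \<le> v k * \<bar>s - \<tau> k\<bar> + w k * \<bar>s - \<tau> k\<bar>"
    using assms unfolding coord_lip_def by (intro norm_triangle_le add_mono) blast+
  finally show "norm (g (\<tau>(k := s)) + h (\<tau>(k := s)) - (g \<tau> + h \<tau>)) \<le> (v k + w k) * \<bar>s - \<tau> k\<bar>"
    by (simp add: algebra_simps)
qed

lemma coord_lip_scaleR:
  assumes "coord_lip w g"
  shows "coord_lip (\<lambda>k. \<bar>c\<bar> * w k) (\<lambda>\<tau>. c *\<^sub>R g \<tau>)"
  unfolding coord_lip_def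
proof (intro allI)
  fix \<tau> :: "nat \<Rightarrow> real" and k s
  have "norm (c *\<^sub>R g (\<tau>(k := s)) - c *\<^sub>R g \<tau>) = \<bar>c\<bar> * norm (g (\<tau>(k := s)) - g \<tau>)"
    by (metis norm_scaleR scaleR_diff_right)
  also have "\<dots> \<le> \<bar>c\<bar> * (w k * \<bar>s - \<tau> k\<bar>)"
    using assms unfolding coord_lip_def by (intro mult_left_mono) auto
  finally show "norm (c *\<^sub>R g (\<tau>(k := s)) - c *\<^sub>R g \<tau>) \<le> \<bar>c\<bar> * w k * \<bar>s - \<tau> k\<bar>"
    by simp
qed

lemma coord_lip_diff:
  assumes "coord_lip v g" "coord_lip w h"
  shows "coord_lip (\<lambda>k. v k + w k) (\<lambda>\<tau>. g \<tau> - h \<tau>)"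
  using coord_lip_add[OF assms(1) coord_lip_scaleR[OF assms(2), of "-1"]] by simp

lemma coord_lip_upd_comp:
  assumes "coord_lip w g"
  shows "coord_lip w (\<lambda>\<tau>. g (\<tau>(k := c)))"
  unfolding coord_lip_def
proof (intro allI)
  fix \<tau> :: "nat \<Rightarrow> real" and j s
  show "norm (g ((\<tau>(j := s))(k := c)) - g (\<tau>(k := c))) \<le> w j * \<bar>s - \<tau> j\<bar>"
  proof (cases "j = k")
    case True
    then show ?thesis using coord_lip_nonneg[OF assms] by simp
  next
    case False
    then show ?thesis
      using assms[unfolded coord_lip_def, rule_format, of "\<tau>(k := c)" j s] by (simp add: fun_upd_twist)
  qed
qed

lemma coord_lip_continuous:
  assumes "coord_lip w g"
  shows "continuous_on X (\<lambda>s. g (\<tau>(k := s)))"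
proof (rule lipschitz_on_continuous_on)
  show "(w k)-lipschitz_on X (\<lambda>s. g (\<tau>(k := s)))"
    using coord_lip_upd[OF assms] coord_lip_nonneg[OF assms]
    by (intro lipschitz_onI) (auto simp: dist_norm)
qed

lemma coord_lip_integrable:
  fixes g :: "(nat \<Rightarrow> real) \<Rightarrow> 'y::banach"
  assumes "coord_lip w g"
  shows "(\<lambda>s. g (\<tau>(k := s))) integrable_on {a..b}"
  by (rule integrable_continuous_interval[OF coord_lip_continuous[OF assms]])

lemma coord_mean_add:
  assumes "coord_lip v g" "coord_lip w h"
  shows "coord_mean k (\<lambda>\<tau>. g \<tau> + h \<tau>) = (\<lambda>\<tau>. coord_mean k g \<tau> + coord_mean k h \<tau>)"
  unfolding coord_mean_def
  by (intro ext integral_add coord_lip_integrable[OF assms(1)] coord_lip_integrable[OF assms(2)])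

lemma coord_mean_scaleR: "coord_mean k (\<lambda>\<tau>. c *\<^sub>R g \<tau>) = (\<lambda>\<tau>. c *\<^sub>R coord_mean k g \<tau>)"
  unfolding coord_mean_def by simp

lemma coord_mean_diff:
  assumes "coord_lip v g" "coord_lip w h"
  shows "coord_mean k (\<lambda>\<tau>. g \<tau> - h \<tau>) = (\<lambda>\<tau>. coord_mean k g \<tau> - coord_mean k h \<tau>)"
  unfolding coord_mean_def
  by (intro ext integral_diff coord_lip_integrable[OF assms(1)] coord_lip_integrable[OF assms(2)])

lemma norm_coord_mean_le:
  assumes "coord_lip w g" "\<And>s. s \<in> {0..1} \<Longrightarrow> norm (g (\<tau>(k := s))) \<le> B"
  shows "norm (coord_mean k g \<tau>) \<le> B"
proof -
  have "norm (integral {0..1} (\<lambda>s. g (\<tau>(k := s)))) \<le> B * (1 - 0)"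
    by (rule integral_bound) (use assms in \<open>auto intro: coord_lip_continuous\<close>)
  then show ?thesis by (simp add: coord_mean_def)
qed

lemma coord_lip_coord_mean:
  assumes g: "coord_lip w g"
  shows "coord_lip w (coord_mean k g)"
  unfolding coord_lip_def
proof (intro allI)
  fix \<tau> :: "nat \<Rightarrow> real" and j s
  show "norm (coord_mean k g (\<tau>(j := s)) - coord_mean k g \<tau>) \<le> w j * \<bar>s - \<tau> j\<bar>"
  proof (cases "j = k")
    case True
    then show ?thesis using coord_lip_nonneg[OF g] by (simp add: coord_mean_def)
  next
    case False
    have "coord_mean k g (\<tau>(j := s)) - coord_mean k g \<tau>
      = coord_mean k (\<lambda>\<sigma>. g (\<sigma>(j := s)) - g \<sigma>) \<tau>"
      using False coord_mean_diff[OF coord_lip_upd_comp[OF g, of j s] g, of k]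
      by (simp add: coord_mean_def fun_upd_twist fun_eq_iff)
    also have "norm \<dots> \<le> w j * \<bar>s - \<tau> j\<bar>"
    proof (rule norm_coord_mean_le[OF coord_lip_diff[OF coord_lip_upd_comp[OF g] g]])
      fix r
      show "norm (g (\<tau>(k := r, j := s)) - g (\<tau>(k := r))) \<le> w j * \<bar>s - \<tau> j\<bar>"
        using g[unfolded coord_lip_def, rule_format, of "\<tau>(k := r)" j s] False by simp
    qed
    finally show ?thesis .
  qed
qed

lemma coord_mean_commute:
  assumes g: "coord_lip w g" and "j \<noteq> k"
  shows "coord_mean j (coord_mean k g) = coord_mean k (coord_mean j g)"
proof
  fix \<tau>
  have "continuous_on UNIV (\<lambda>(s, r). g (\<tau>(j := s, k := r)))"
  proof (rule lipschitz_on_continuous_on)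
    show "(w j + w k)-lipschitz_on UNIV (\<lambda>(s, r). g (\<tau>(j := s, k := r)))"
    proof (rule lipschitz_onI)
      fix p q :: "real \<times> real"
      obtain s r s' r' where pq: "p = (s, r)" "q = (s', r')" by fastforce
      have "g (\<tau>(j := s, k := r)) - g (\<tau>(j := s', k := r')) =
        (g (\<tau>(j := s, k := r)) - g (\<tau>(j := s, k := r'))) + (g (\<tau>(k := r', j := s)) - g (\<tau>(k := r', j := s')))"
        using assms(2) by (simp add: fun_upd_twist)
      also have "norm \<dots> \<le> w k * \<bar>r - r'\<bar> + w j * \<bar>s - s'\<bar>"
        by (intro norm_triangle_le add_mono coord_lip_upd[OF g])
      also have "\<dots> \<le> w k * dist p q + w j * dist p q"
        using coord_lip_nonneg[OF g] dist_fst_le[of p q] dist_snd_le[of p q] pq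
        by (intro add_mono mult_left_mono) (auto simp: dist_real_def)
      finally show "dist (case p of (s, r) \<Rightarrow> g (\<tau>(j := s, k := r))) (case q of (s, r) \<Rightarrow> g (\<tau>(j := s, k := r)))
        \<le> (w j + w k) * dist p q"
        by (simp add: pq dist_norm algebra_simps)
    qed (simp add: coord_lip_nonneg[OF g])
  qed
  then have "continuous_on (cbox (0, 0) (1, 1)) (\<lambda>(s, r). g (\<tau>(j := s, k := r)))"
    by (rule continuous_on_subset) simp
  from integral_swap_continuous[OF this]
  show "coord_mean j (coord_mean k g) \<tau> = coord_mean k (coord_mean j g) \<tau>"
    using assms(2) by (simp add: coord_mean_def fun_upd_twist)
qed

lemma coord_mean_idem: "coord_mean k (coord_mean k g) = coord_mean k g"
  by (simp add: coord_mean_def fun_eq_iff)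

text \<open>
  Averaging over a coordinate twice is averaging once. This lets the \<open>k\<close>-th integration be carried out
  first, which is where a translation in direction \<open>k\<close> becomes a difference of boundary values.
\<close>

lemma cube_mean_coord_mean:
  "coord_lip w g \<Longrightarrow> k < n \<Longrightarrow> cube_mean n (coord_mean k g) = cube_mean n g"
proof (induction n arbitrary: g)
  case (Suc n)
  show ?case
  proof (cases "k = n")
    case False
    then have "cube_mean n (coord_mean n (coord_mean k g)) = cube_mean n (coord_mean k (coord_mean n g))"
      using coord_mean_commute[OF Suc.prems(1)] by metis
    also have "\<dots> = cube_mean n (coord_mean n g)"
      using Suc.prems False by (intro Suc.IH coord_lip_coord_mean) auto
    finally show ?thesis by simp
  qed (simp add: coord_mean_idem)
qed simp

lemma cube_mean_diff:
  "coord_lip v g \<Longrightarrow> coord_lip w h \<Longrightarrow>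
    cube_mean n (\<lambda>\<tau>. g \<tau> - h \<tau>) \<tau> = cube_mean n g \<tau> - cube_mean n h \<tau>"
proof (induction n arbitrary: g h)
  case (Suc n)
  then show ?case
    using Suc.IH[OF coord_lip_coord_mean coord_lip_coord_mean] by (simp add: coord_mean_diff)
qed simp

lemma cube_mean_add:
  "coord_lip v g \<Longrightarrow> coord_lip w h \<Longrightarrow>
    cube_mean n (\<lambda>\<tau>. g \<tau> + h \<tau>) \<tau> = cube_mean n g \<tau> + cube_mean n h \<tau>"
proof (induction n arbitrary: g h)
  case (Suc n)
  then show ?case
    using Suc.IH[OF coord_lip_coord_mean coord_lip_coord_mean] by (simp add: coord_mean_add)
qed simp

lemma cube_mean_scaleR: "cube_mean n (\<lambda>\<tau>. c *\<^sub>R g \<tau>) \<tau> = c *\<^sub>R cube_mean n g \<tau>"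
  by (induction n arbitrary: g) (simp_all add: coord_mean_scaleR)

lemma cube_mean_zero: "cube_mean n (\<lambda>\<tau>. 0) \<tau> = 0"
  using cube_mean_scaleR[of n 0 "\<lambda>_. 0" \<tau>] by simp

lemma cube_mean_sum:
  fixes N :: nat
  assumes "\<And>i. i < N \<Longrightarrow> coord_lip (w i) (g i)"
  shows "coord_lip (\<lambda>k. \<Sum>i<N. w i k) (\<lambda>\<tau>. \<Sum>i<N. g i \<tau>) \<and>
    cube_mean n (\<lambda>\<tau>. \<Sum>i<N. g i \<tau>) \<tau> = (\<Sum>i<N. cube_mean n (g i) \<tau>)"
  using assms
proof (induction N)
  case 0
  then show ?case by (simp add: cube_mean_zero coord_lip_def)
next
  case (Suc N)
  then show ?case
    using coord_lip_add[of "\<lambda>k. \<Sum>i<N. w i k" "\<lambda>\<tau>. \<Sum>i<N. g i \<tau>" "w N" "g N"]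
      cube_mean_add[of "\<lambda>k. \<Sum>i<N. w i k" "\<lambda>\<tau>. \<Sum>i<N. g i \<tau>" "w N" "g N" n \<tau>] by simp
qed

lemma norm_cube_mean_le:
  "coord_lip w g \<Longrightarrow> (\<And>\<tau>. (\<And>k. \<tau> k \<in> {0..1}) \<Longrightarrow> norm (g \<tau>) \<le> B) \<Longrightarrow>
    (\<And>k. \<tau> k \<in> {0..1}) \<Longrightarrow> norm (cube_mean n g \<tau>) \<le> B"
proof (induction n arbitrary: g)
  case (Suc n)
  show ?case unfolding cube_mean.simps
  proof (rule Suc.IH[OF coord_lip_coord_mean[OF Suc.prems(1)]])
    show "norm (coord_mean n g \<sigma>) \<le> B" if "\<And>k. \<sigma> k \<in> {0..1}" for \<sigma>
      using that by (intro norm_coord_mean_le[OF Suc.prems(1)] Suc.prems(2)) auto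
  qed (rule Suc.prems(3))
qed simp

lemma cube_mean_functional_const:
  fixes f :: "'y::banach \<Rightarrow> real"
  assumes f: "bounded_linear f"
  shows "coord_lip w g \<Longrightarrow> (\<And>\<tau>. f (g \<tau>) = c) \<Longrightarrow> f (cube_mean n g \<tau>) = c"
proof (induction n arbitrary: g)
  case (Suc n)
  have "f (coord_mean n g \<sigma>) = c" for \<sigma>
  proof -
    have "f (coord_mean n g \<sigma>) = integral {0..1} (f \<circ> (\<lambda>s. g (\<sigma>(n := s))))"
      unfolding coord_mean_def
      by (rule integral_linear[symmetric, OF coord_lip_integrable[OF Suc.prems(1)] f])
    also have "f \<circ> (\<lambda>s. g (\<sigma>(n := s))) = (\<lambda>s. c)"
      using Suc.prems(2) by (simp only: o_def)
    finally show ?thesis by simp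
  qed
  then show ?case
    using Suc.IH[OF coord_lip_coord_mean[OF Suc.prems(1)]] by simp
qed simp

text \<open>
  Shifting the interval of integration by \<open>\<delta>\<close> trades a piece of length \<open>\<delta>\<close> at \<open>0\<close> for one at \<open>1\<close>;
  replacing the function by its boundary values there costs an error quadratic in \<open>\<delta>\<close>.
\<close>

lemma lipschitz_shift_integral_pos:
  fixes G :: "real \<Rightarrow> 'y::banach"
  assumes G: "\<And>s r. norm (G s - G r) \<le> W * \<bar>s - r\<bar>" and \<delta>: "0 \<le> \<delta>"
  shows "norm (integral {0..1} (\<lambda>s. G (s + \<delta>) - G s) - \<delta> *\<^sub>R (G 1 - G 0)) \<le> 2 * W * \<delta>\<^sup>2"
proof -
  have "0 \<le> W" using order_trans[OF norm_ge_zero G[of 1 0]] by simp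
  have cont: "continuous_on X G" for X
    using G \<open>0 \<le> W\<close> by (intro lipschitz_on_continuous_on[of W] lipschitz_onI) (auto simp: dist_norm)
  have cont': "continuous_on X (\<lambda>s. G (s + \<delta>))" for X
    by (rule continuous_on_compose2[OF cont[of UNIV]]) (auto intro!: continuous_intros)
  have int: "G integrable_on {a..b}" for a b
    by (rule integrable_continuous_interval[OF cont])
  have near: "norm (integral {c..c+\<delta>} G - \<delta> *\<^sub>R G c) \<le> W * \<delta>\<^sup>2" for c
  proof -
    have "integral {c..c+\<delta>} G - \<delta> *\<^sub>R G c = integral {c..c+\<delta>} (\<lambda>s. G s - G c)"
      using \<delta> integral_diff[OF int integrable_const_ivl, of c "c + \<delta>" "G c"] by simp
    also have "norm \<dots> \<le> (W * \<delta>) * (c + \<delta> - c)"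
    proof (rule integral_bound)
      fix s assume "s \<in> {c..c+\<delta>}"
      then have "W * \<bar>s - c\<bar> \<le> W * \<delta>"
        using \<open>0 \<le> W\<close> by (intro mult_left_mono) auto
      then show "norm (G s - G c) \<le> W * \<delta>" using G[of s c] by linarith
    qed (use \<delta> in \<open>auto intro!: continuous_intros cont\<close>)
    finally show ?thesis by (simp add: power2_eq_square)
  qed
  have "integral {0..1} (\<lambda>s. G (s + \<delta>)) = integral {0+\<delta>..1+\<delta>} G"
    using integral_shift_Icc_real[of 0 1 G \<delta>] by (simp add: o_def add.commute)
  also have "\<dots> = integral {0..1+\<delta>} G - integral {0..\<delta>} G"
    using \<delta> Henstock_Kurzweil_Integration.integral_combine[OF _ _ int, of 0 \<delta> "1+\<delta>"]
    by (simp add: eq_diff_eq add.commute)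
  also have "integral {0..1+\<delta>} G = integral {0..1} G + integral {1..1+\<delta>} G"
    using \<delta> Henstock_Kurzweil_Integration.integral_combine[OF _ _ int, of 0 1 "1+\<delta>"] by simp
  finally have "integral {0..1} (\<lambda>s. G (s + \<delta>)) = integral {0..1} G + integral {1..1+\<delta>} G - integral {0..\<delta>} G" .
  moreover have "integral {0..1} (\<lambda>s. G (s + \<delta>) - G s) = integral {0..1} (\<lambda>s. G (s + \<delta>)) - integral {0..1} G"
    by (intro integral_diff integrable_continuous_interval cont cont')
  ultimately have "integral {0..1} (\<lambda>s. G (s + \<delta>) - G s) - \<delta> *\<^sub>R (G 1 - G 0) =
     (integral {1..1+\<delta>} G - \<delta> *\<^sub>R G 1) - (integral {0..0+\<delta>} G - \<delta> *\<^sub>R G 0)"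
    by (simp add: scaleR_diff_right)
  also have "norm \<dots> \<le> W * \<delta>\<^sup>2 + W * \<delta>\<^sup>2"
    by (rule order_trans[OF norm_triangle_ineq4 add_mono[OF near near]])
  finally show ?thesis by simp
qed

text \<open>
  A negative shift is undone by a positive shift of the translated function. The boundary values
  then move by \<open>\<delta>\<close> as well, which accounts for the larger constant.
\<close>

lemma lipschitz_shift_integral:
  fixes G :: "real \<Rightarrow> 'y::banach"
  assumes G: "\<And>s r. norm (G s - G r) \<le> W * \<bar>s - r\<bar>"
  shows "norm (integral {0..1} (\<lambda>s. G (s + \<delta>) - G s) - \<delta> *\<^sub>R (G 1 - G 0)) \<le> 4 * W * \<delta>\<^sup>2"
proof (cases "\<delta> \<ge> 0")
  case True
  have "0 \<le> W" using order_trans[OF norm_ge_zero G[of 1 0]] by simp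
  then have "2 * W * \<delta>\<^sup>2 \<le> 4 * W * \<delta>\<^sup>2" by (intro mult_right_mono) auto
  then show ?thesis
    using lipschitz_shift_integral_pos[OF G True] by linarith
next
  case False
  define G' where "G' s = G (s + \<delta>)" for s
  define I where "I = integral {0..1} (\<lambda>s. G (s + \<delta>) - G s)"
  have G': "norm (G' s - G' r) \<le> W * \<bar>s - r\<bar>" for s r
    using G[of "s + \<delta>" "r + \<delta>"] by (simp add: G'_def)
  have "I = - integral {0..1} (\<lambda>s. G' (s + - \<delta>) - G' s)"
    unfolding I_def integral_neg[symmetric] by (simp add: G'_def)
  then have "I - \<delta> *\<^sub>R (G 1 - G 0) =
     - (integral {0..1} (\<lambda>s. G' (s + - \<delta>) - G' s) - (- \<delta>) *\<^sub>R (G' 1 - G' 0))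
     + \<delta> *\<^sub>R ((G' 1 - G 1) - (G' 0 - G 0))"
    by (simp add: algebra_simps)
  also have "norm \<dots> \<le> 2 * W * (- \<delta>)\<^sup>2 + (- \<delta>) * (W * (- \<delta>) + W * (- \<delta>))"
  proof (rule order_trans[OF norm_triangle_ineq add_mono])
    show "norm (- (integral {0..1} (\<lambda>s. G' (s + - \<delta>) - G' s) - (- \<delta>) *\<^sub>R (G' 1 - G' 0))) \<le> 2 * W * (- \<delta>)\<^sup>2"
      unfolding norm_minus_cancel using False by (intro lipschitz_shift_integral_pos G') auto
    have "norm (\<delta> *\<^sub>R ((G' 1 - G 1) - (G' 0 - G 0))) = (- \<delta>) * norm ((G' 1 - G 1) - (G' 0 - G 0))"
      using False by simp
    also have "\<dots> \<le> (- \<delta>) * (W * (- \<delta>) + W * (- \<delta>))"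
      using False G[of "1 + \<delta>" 1] G[of \<delta> 0]
      by (intro mult_left_mono order_trans[OF norm_triangle_ineq4 add_mono]) (auto simp: G'_def)
    finally show "norm (\<delta> *\<^sub>R ((G' 1 - G 1) - (G' 0 - G 0))) \<le> (- \<delta>) * (W * (- \<delta>) + W * (- \<delta>))" .
  qed
  finally show ?thesis by (simp add: I_def power2_eq_square algebra_simps)
qed

section \<open>Linearizing a Lipschitz map\<close>

text \<open>
  Let \<open>H \<epsilon>\<close> be the average over \<open>t\<close> of \<open>h (t + \<epsilon> a)\<close>. The hypothesis bounds \<open>H \<epsilon> - H 0\<close> by \<open>\<epsilon> B\<close>. Moving from
  \<open>t\<close> to \<open>t + \<epsilon> a\<close> one coordinate at a time and integrating in that coordinate first shows that
  \<open>H \<epsilon> - H 0\<close> equals \<open>\<epsilon>\<close> times the sum in the conclusion up to \<open>O(\<epsilon>\<^sup>2)\<close>, so that sum is the derivative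
  of \<open>H\<close> at \<open>0\<close>.
\<close>

lemma averaged_increments_bound:
  fixes h :: "(nat \<Rightarrow> real) \<Rightarrow> 'y::banach" and n :: nat
  assumes h: "coord_lip w h"
    and B: "\<And>\<epsilon> t. \<lbrakk>0 < \<epsilon>; \<And>k. k < n \<Longrightarrow> \<bar>\<epsilon> * a k\<bar> \<le> 1; \<And>k. t k \<in> {0..1}\<rbrakk> \<Longrightarrow>
      norm (h (\<lambda>k. t k + (if k < n then \<epsilon> * a k else 0)) - h t) \<le> \<epsilon> * B"
  shows "norm (\<Sum>k<n. a k *\<^sub>R cube_mean n (\<lambda>\<tau>. h (\<tau>(k := 1)) - h (\<tau>(k := 0))) (\<lambda>_. 0)) \<le> B"
proof -
  define \<Delta> where "\<Delta> k \<tau> = h (\<tau>(k := 1)) - h (\<tau>(k := 0))" for k \<tau>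
  define S where "S = (\<Sum>k<n. a k *\<^sub>R cube_mean n (\<Delta> k) (\<lambda>_. 0))"
  define W where "W = (\<Sum>j<n. w j * \<bar>a j\<bar>)"
  define C where "C k = 4 * w k * (a k)\<^sup>2 + 2 * \<bar>a k\<bar> * W" for k
  have w0: "0 \<le> w k" for k
    by (rule coord_lip_nonneg[OF h])
  have \<Delta>: "coord_lip (\<lambda>k. w k + w k) (\<Delta> k)" for k
    unfolding \<Delta>_def by (intro coord_lip_diff coord_lip_upd_comp h)
  have small: "norm S \<le> B + \<epsilon> * (\<Sum>k<n. C k)"
    if \<epsilon>: "0 < \<epsilon>" and \<epsilon>a: "\<And>k. k < n \<Longrightarrow> \<bar>\<epsilon> * a k\<bar> \<le> 1" for \<epsilon>
  proof -
    \<comment> \<open>\<open>sh k t\<close> is \<open>t\<close> after its first \<open>k\<close> coordinates have been moved.\<close>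
    define sh where "sh k t = (\<lambda>j. t j + (if j < k then \<epsilon> * a j else 0))" for k and t :: "nat \<Rightarrow> real"
    define D where "D k t = h (sh (Suc k) t) - h (sh k t)" for k t
    have sh_upd: "sh k (t(j := s)) = (sh k t)(j := s + (if j < k then \<epsilon> * a j else 0))" for k t j s
      by (auto simp: sh_def)
    have sh_Suc: "sh (Suc k) t = (sh k t)(k := t k + \<epsilon> * a k)" for k t
      by (auto simp: sh_def)
    have hsh: "coord_lip w (\<lambda>t. h (sh k t))" for k
      unfolding coord_lip_def
    proof (intro allI)
      fix t :: "nat \<Rightarrow> real" and j s
      have eq: "s + (if j < k then \<epsilon> * a j else 0) - sh k t j = s - t j"
        by (simp add: sh_def)
      have "norm (h ((sh k t)(j := s + (if j < k then \<epsilon> * a j else 0))) - h (sh k t))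
        \<le> w j * \<bar>s + (if j < k then \<epsilon> * a j else 0) - sh k t j\<bar>"
        using h unfolding coord_lip_def by blast
      then show "norm (h (sh k (t(j := s))) - h (sh k t)) \<le> w j * \<bar>s - t j\<bar>"
        unfolding eq sh_upd .
    qed
    have D: "coord_lip (\<lambda>k. w k + w k) (D k)" for k
      unfolding D_def by (intro coord_lip_diff hsh)
    have shift: "norm (h (sh k t) - h t) \<le> \<epsilon> * W" if "k \<le> n" for k t
    proof -
      have "norm (h (sh k t) - h t) \<le> (\<Sum>j<k. w j * (\<epsilon> * \<bar>a j\<bar>))"
      proof (induction k)
        case (Suc k)
        have "norm (h (sh (Suc k) t) - h (sh k t)) \<le> w k * \<bar>t k + \<epsilon> * a k - sh k t k\<bar>"
          using h unfolding coord_lip_def sh_Suc by blast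
        also have "\<dots> = w k * (\<epsilon> * \<bar>a k\<bar>)"
          using \<epsilon> by (simp add: sh_def abs_mult)
        finally show ?case
          using Suc.IH norm_triangle_ineq[of "h (sh (Suc k) t) - h (sh k t)" "h (sh k t) - h t"] by simp
      qed (simp add: sh_def)
      also have "\<dots> \<le> (\<Sum>j<n. w j * (\<epsilon> * \<bar>a j\<bar>))"
        using that \<epsilon> w0 by (intro sum_mono2) auto
      also have "\<dots> = \<epsilon> * W"
        by (simp add: W_def sum_distrib_left algebra_simps)
      finally show ?thesis .
    qed
    have close: "norm (coord_mean k (D k) t - (\<epsilon> * a k) *\<^sub>R \<Delta> k t) \<le> \<epsilon>\<^sup>2 * C k" if k: "k < n" for k t
    proof -
      define \<sigma> where "\<sigma> = sh k t"
      define G where "G s = h (\<sigma>(k := s))" for s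
      have G: "norm (G s - G r) \<le> w k * \<bar>s - r\<bar>" for s r
        unfolding G_def by (rule coord_lip_upd[OF h])
      have "coord_mean k (D k) t = integral {0..1} (\<lambda>s. G (s + \<epsilon> * a k) - G s)"
        unfolding coord_mean_def D_def G_def sh_Suc by (simp add: sh_upd \<sigma>_def)
      then have "norm (coord_mean k (D k) t - (\<epsilon> * a k) *\<^sub>R (G 1 - G 0)) \<le> 4 * w k * (\<epsilon> * a k)\<^sup>2"
        using lipschitz_shift_integral[OF G] by simp
      moreover have "norm ((\<epsilon> * a k) *\<^sub>R (G 1 - G 0) - (\<epsilon> * a k) *\<^sub>R \<Delta> k t) \<le> \<epsilon> * \<bar>a k\<bar> * (\<epsilon> * W + \<epsilon> * W)"
      proof -
        have G_sh: "G c = h (sh k (t(k := c)))" for c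
          by (simp add: G_def \<sigma>_def sh_upd)
        have eq: "(\<epsilon> * a k) *\<^sub>R (G 1 - G 0) - (\<epsilon> * a k) *\<^sub>R \<Delta> k t =
          (\<epsilon> * a k) *\<^sub>R ((h (sh k (t(k := 1))) - h (t(k := 1))) - (h (sh k (t(k := 0))) - h (t(k := 0))))"
          by (simp add: \<Delta>_def G_sh algebra_simps)
        have "norm ((\<epsilon> * a k) *\<^sub>R (G 1 - G 0) - (\<epsilon> * a k) *\<^sub>R \<Delta> k t) = \<epsilon> * \<bar>a k\<bar> *
          norm ((h (sh k (t(k := 1))) - h (t(k := 1))) - (h (sh k (t(k := 0))) - h (t(k := 0))))"
          unfolding eq norm_scaleR using \<epsilon> by (simp add: abs_mult)
        also have "\<dots> \<le> \<epsilon> * \<bar>a k\<bar> * (\<epsilon> * W + \<epsilon> * W)"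
          using k \<epsilon> by (intro mult_left_mono order_trans[OF norm_triangle_ineq4 add_mono] shift) auto
        finally show ?thesis .
      qed
      ultimately have "norm (coord_mean k (D k) t - (\<epsilon> * a k) *\<^sub>R \<Delta> k t) \<le>
          4 * w k * (\<epsilon> * a k)\<^sup>2 + \<epsilon> * \<bar>a k\<bar> * (\<epsilon> * W + \<epsilon> * W)"
        by (rule norm_diff_triangle_le)
      then show ?thesis
        by (simp add: C_def power2_eq_square algebra_simps)
    qed
    define X where "X = cube_mean n (\<lambda>t. h (sh n t) - h (sh 0 t)) (\<lambda>_. 0)"
    have Xle: "norm X \<le> \<epsilon> * B"
      unfolding X_def
    proof (rule norm_cube_mean_le[OF coord_lip_diff[OF hsh hsh]])
      fix t :: "nat \<Rightarrow> real" assume "\<And>k. t k \<in> {0..1}"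
      then show "norm (h (sh n t) - h (sh 0 t)) \<le> \<epsilon> * B"
        using B[OF \<epsilon> \<epsilon>a, of t] by (simp add: sh_def)
    qed auto
    have "X = cube_mean n (\<lambda>t. \<Sum>k<n. D k t) (\<lambda>_. 0)"
      unfolding X_def D_def by (simp add: sum_lessThan_telescope[of "\<lambda>k. h (sh k t)" n for t])
    also have "\<dots> = (\<Sum>k<n. cube_mean n (D k) (\<lambda>_. 0))"
      using cube_mean_sum[of n "\<lambda>_ k. w k + w k" D] D by simp
    also have "\<dots> = (\<Sum>k<n. cube_mean n (coord_mean k (D k)) (\<lambda>_. 0))"
      using cube_mean_coord_mean[OF D] by (intro sum.cong) auto
    finally have "X - \<epsilon> *\<^sub>R S =
      (\<Sum>k<n. cube_mean n (\<lambda>t. coord_mean k (D k) t - (\<epsilon> * a k) *\<^sub>R \<Delta> k t) (\<lambda>_. 0))"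
      using cube_mean_diff[OF coord_lip_coord_mean[OF D] coord_lip_scaleR[OF \<Delta>]]
      by (simp add: S_def scaleR_sum_right sum_subtractf cube_mean_scaleR)
    also have "norm \<dots> \<le> (\<Sum>k<n. \<epsilon>\<^sup>2 * C k)"
      by (rule sum_norm_le, rule norm_cube_mean_le[OF coord_lip_diff[OF coord_lip_coord_mean[OF D] coord_lip_scaleR[OF \<Delta>]]])
        (auto intro: close)
    finally have "norm (X - \<epsilon> *\<^sub>R S) \<le> \<epsilon>\<^sup>2 * (\<Sum>k<n. C k)"
      by (simp add: sum_distrib_left)
    then have "norm (\<epsilon> *\<^sub>R S) \<le> \<epsilon> * B + \<epsilon>\<^sup>2 * (\<Sum>k<n. C k)"
      using Xle norm_triangle_sub[of "\<epsilon> *\<^sub>R S" X] by (simp add: norm_minus_commute)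
    then have "\<epsilon> * norm S \<le> \<epsilon> * (B + \<epsilon> * (\<Sum>k<n. C k))"
      using \<epsilon> by (simp add: power2_eq_square algebra_simps)
    then show ?thesis using \<epsilon> by simp
  qed
  define A where "A = 1 + (\<Sum>k<n. \<bar>a k\<bar>)"
  have A: "\<bar>a k\<bar> \<le> A" "0 < A" if "k < n" for k
  proof -
    have "\<bar>a k\<bar> \<le> (\<Sum>k<n. \<bar>a k\<bar>)"
      using that by (intro member_le_sum) auto
    then show "\<bar>a k\<bar> \<le> A" "0 < A" unfolding A_def by linarith+
  qed
  have A0: "0 < A" unfolding A_def by (intro add_pos_nonneg sum_nonneg) auto
  have ev: "\<forall>\<^sub>F \<epsilon> in at_right 0. norm S \<le> B + \<epsilon> * (\<Sum>k<n. C k)"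
    unfolding eventually_at_right_field
  proof (intro exI[of _ "1 / A"] conjI allI impI)
    fix \<epsilon> :: real assume \<epsilon>: "0 < \<epsilon>" "\<epsilon> < 1 / A"
    have "\<bar>\<epsilon> * a k\<bar> \<le> 1" if "k < n" for k
    proof -
      have "\<bar>\<epsilon> * a k\<bar> \<le> \<epsilon> * A"
        using \<epsilon> A[OF that] by (simp add: abs_mult mult_left_mono)
      also have "\<dots> \<le> 1" using \<epsilon> A0 by (simp add: field_simps)
      finally show ?thesis .
    qed
    then show "norm S \<le> B + \<epsilon> * (\<Sum>k<n. C k)"
      using small \<epsilon> by blast
  qed (use A0 in simp)
  have "((\<lambda>\<epsilon>. B + \<epsilon> * (\<Sum>k<n. C k)) \<longlongrightarrow> B + 0 * (\<Sum>k<n. C k)) (at_right 0)"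
    by (intro tendsto_intros)
  then have "norm S \<le> B + 0 * (\<Sum>k<n. C k)"
    by (rule tendsto_lowerbound[OF _ ev]) simp
  then show ?thesis by (simp add: S_def \<Delta>_def[abs_def])
qed

text \<open>
  The Godefroy-Kalton linearization. The vector \<open>R k\<close> is the limit of the averages, over growing cubes, of
  the increments of \<open>\<phi>\<close> along edges equal to \<open>x k\<close>. A functional \<open>f\<close> for which \<open>f (\<phi> u - \<phi> v)\<close> depends only on
  \<open>u - v\<close> takes one and the same value on all these increments, hence on their average; this is the last property.
\<close>

theorem linearize_lipschitz:
  fixes x :: "nat \<Rightarrow> 'v::real_normed_vector" and \<phi> :: "'v \<Rightarrow> 'y::banach"
  assumes x: "summable (\<lambda>k. norm (x k))"
    and D: "\<And>\<tau> n. (\<And>k. \<bar>\<tau> k\<bar> \<le> 2) \<Longrightarrow> (\<Sum>k<n. \<tau> k *\<^sub>R x k) \<in> D"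
    and lip: "\<And>u v. \<lbrakk>u \<in> D; v \<in> D\<rbrakk> \<Longrightarrow> norm (\<phi> u - \<phi> v) \<le> norm (u - v)"
  obtains R where "\<And>n a. norm (\<Sum>k<n. a k *\<^sub>R R k) \<le> norm (\<Sum>k<n. a k *\<^sub>R x k)"
    "\<And>(f :: 'y \<Rightarrow> real) g k. \<lbrakk>bounded_linear f; \<And>u v. \<lbrakk>u \<in> D; v \<in> D\<rbrakk> \<Longrightarrow> f (\<phi> u - \<phi> v) = g (u - v)\<rbrakk> \<Longrightarrow> f (R k) = g (x k)"
proof -
  \<comment> \<open>Truncating the coordinates makes \<open>h n\<close> total. The averages run over \<open>[0,1]\<close> and their
      translates by at most \<open>1\<close>, so a truncation at \<open>2\<close> is never felt there.\<close>
  define cl where "cl s = max (-2) (min 2 s)" for s :: real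
  define h where "h n \<tau> = \<phi> (\<Sum>k<n. cl (\<tau> k) *\<^sub>R x k)" for n and \<tau> :: "nat \<Rightarrow> real"
  define \<Delta> where "\<Delta> n k \<tau> = h n (\<tau>(k := 1)) - h n (\<tau>(k := 0))" for n k \<tau>
  define z where "z k n = cube_mean n (\<Delta> n k) (\<lambda>_. 0)" for k n
  have cl: "\<bar>cl s\<bar> \<le> 2" for s by (auto simp: cl_def)
  have inD: "(\<Sum>k<n. cl (\<tau> k) *\<^sub>R x k) \<in> D" for n \<tau>
    using D[of "\<lambda>k. cl (\<tau> k)"] cl by blast
  have h: "coord_lip (\<lambda>k. norm (x k)) (h n)" for n
    unfolding coord_lip_def
  proof (intro allI)
    fix \<tau> :: "nat \<Rightarrow> real" and j s
    have "norm (h n (\<tau>(j := s)) - h n \<tau>) \<le>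
      norm ((\<Sum>k<n. cl ((\<tau>(j := s)) k) *\<^sub>R x k) - (\<Sum>k<n. cl (\<tau> k) *\<^sub>R x k))"
      unfolding h_def by (intro lip inD)
    also have "(\<Sum>k<n. cl ((\<tau>(j := s)) k) *\<^sub>R x k) - (\<Sum>k<n. cl (\<tau> k) *\<^sub>R x k) =
      (\<Sum>k<n. if k = j then (cl s - cl (\<tau> j)) *\<^sub>R x j else 0)"
      unfolding sum_subtractf[symmetric] by (intro sum.cong) (auto simp: algebra_simps)
    also have "norm \<dots> \<le> \<bar>cl s - cl (\<tau> j)\<bar> * norm (x j)"
      by simp
    also have "\<dots> \<le> norm (x j) * \<bar>s - \<tau> j\<bar>"
      by (subst mult.commute, intro mult_left_mono) (auto simp: cl_def)
    finally show "norm (h n (\<tau>(j := s)) - h n \<tau>) \<le> norm (x j) * \<bar>s - \<tau> j\<bar>" .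
  qed
  have \<Delta>: "coord_lip (\<lambda>k. norm (x k) + norm (x k)) (\<Delta> n k)" for n k
    unfolding \<Delta>_def by (intro coord_lip_diff coord_lip_upd_comp h)
  \<comment> \<open>Adding a coordinate perturbs \<open>h\<close> by at most \<open>2 \<parallel>x n\<parallel>\<close>, and an increment involves two
      values of \<open>h\<close>; the differences of consecutive averages are therefore summable.\<close>
  have step: "norm (z k (Suc n) - z k n) \<le> 4 * norm (x n)" for k n
  proof -
    have near: "norm (h (Suc n) \<sigma> - h n \<tau>) \<le> 2 * norm (x n)" if "\<And>j. j < n \<Longrightarrow> \<sigma> j = \<tau> j" for \<sigma> \<tau>
    proof -
      have "norm (h (Suc n) \<sigma> - h n \<tau>) \<le>
        norm ((\<Sum>k<Suc n. cl (\<sigma> k) *\<^sub>R x k) - (\<Sum>k<n. cl (\<tau> k) *\<^sub>R x k))"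
        unfolding h_def by (intro lip inD)
      also have "(\<Sum>k<Suc n. cl (\<sigma> k) *\<^sub>R x k) - (\<Sum>k<n. cl (\<tau> k) *\<^sub>R x k) = cl (\<sigma> n) *\<^sub>R x n"
        using that by simp
      finally show ?thesis
        using mult_right_mono[OF cl norm_ge_zero, of "\<sigma> n" "x n"] by simp
    qed
    have indep: "coord_mean n (\<Delta> n k) = \<Delta> n k"
    proof
      fix t
      have "h n (t(n := s, k := c)) = h n (t(k := c))" for s c
        unfolding h_def by (intro arg_cong[of _ _ \<phi>] sum.cong) auto
      then show "coord_mean n (\<Delta> n k) t = \<Delta> n k t"
        unfolding coord_mean_def \<Delta>_def by simp
    qed
    have "z k (Suc n) - z k n = cube_mean n (coord_mean n (\<Delta> (Suc n) k)) (\<lambda>_. 0) - cube_mean n (coord_mean n (\<Delta> n k)) (\<lambda>_. 0)"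
      by (simp add: z_def indep)
    also have "\<dots> = cube_mean (Suc n) (\<lambda>t. \<Delta> (Suc n) k t - \<Delta> n k t) (\<lambda>_. 0)"
      using cube_mean_diff[OF \<Delta> \<Delta>, of "Suc n"] by simp
    also have "norm \<dots> \<le> 4 * norm (x n)"
    proof (rule norm_cube_mean_le[OF coord_lip_diff[OF \<Delta> \<Delta>]])
      fix t
      have "\<Delta> (Suc n) k t - \<Delta> n k t =
        (h (Suc n) (t(k := 1)) - h n (t(k := 1))) - (h (Suc n) (t(k := 0)) - h n (t(k := 0)))"
        by (simp add: \<Delta>_def)
      also have "norm \<dots> \<le> 2 * norm (x n) + 2 * norm (x n)"
        by (intro order_trans[OF norm_triangle_ineq4 add_mono] near) auto
      finally show "norm (\<Delta> (Suc n) k t - \<Delta> n k t) \<le> 4 * norm (x n)" by simp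
    qed auto
    finally show ?thesis .
  qed
  define R where "R k = lim (z k)" for k
  have conv: "z k \<longlonglongrightarrow> R k" for k
  proof -
    have "summable (\<lambda>n. z k (Suc n) - z k n)"
      using step by (intro summable_comparison_test'[OF summable_mult[OF x, of 4], of 0]) auto
    then have "(\<lambda>n. \<Sum>i<n. z k (Suc i) - z k i) \<longlonglongrightarrow> (\<Sum>n. z k (Suc n) - z k n)"
      by (rule summable_LIMSEQ)
    then have "(\<lambda>n. (z k n - z k 0) + z k 0) \<longlonglongrightarrow> (\<Sum>n. z k (Suc n) - z k n) + z k 0"
      unfolding sum_lessThan_telescope by (intro tendsto_intros)
    then have "convergent (z k)"
      by (auto simp: convergent_def)
    then show ?thesis by (simp add: R_def convergent_LIMSEQ_iff)
  qed
  show ?thesis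
  proof (rule that[of R])
    fix N and a :: "nat \<Rightarrow> real"
    have lim: "(\<lambda>n. norm (\<Sum>k<N. a k *\<^sub>R z k n)) \<longlonglongrightarrow> norm (\<Sum>k<N. a k *\<^sub>R R k)"
      by (intro tendsto_intros conv)
    have "norm (\<Sum>k<N. a k *\<^sub>R z k n) \<le> norm (\<Sum>k<N. a k *\<^sub>R x k)" if n: "N \<le> n" for n
    proof -
      define a' where "a' k = (if k < N then a k else 0)" for k
      have restr: "(\<Sum>k<n. a' k *\<^sub>R y k) = (\<Sum>k<N. a k *\<^sub>R y k)" for y :: "nat \<Rightarrow> 'c::real_vector"
        using n by (intro sum.mono_neutral_cong_right) (auto simp: a'_def)
      have "norm (\<Sum>k<n. a' k *\<^sub>R cube_mean n (\<Delta> n k) (\<lambda>_. 0)) \<le> norm (\<Sum>k<N. a k *\<^sub>R x k)"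
        unfolding \<Delta>_def
      proof (rule averaged_increments_bound[OF h])
        fix \<epsilon> :: real and t :: "nat \<Rightarrow> real"
        assume \<epsilon>: "0 < \<epsilon>" and \<epsilon>a: "\<And>k. k < n \<Longrightarrow> \<bar>\<epsilon> * a' k\<bar> \<le> 1" and t: "\<And>k. t k \<in> {0..1}"
        define t' where "t' k = t k + (if k < n then \<epsilon> * a' k else 0)" for k
        have cl_id: "cl (t k) = t k" "cl (t' k) = t' k" for k
          using t[of k] \<epsilon>a[of k] unfolding cl_def t'_def by (auto simp: abs_le_iff)
        have "norm (h n t' - h n t) \<le> norm ((\<Sum>k<n. cl (t' k) *\<^sub>R x k) - (\<Sum>k<n. cl (t k) *\<^sub>R x k))"
          unfolding h_def by (intro lip inD)
        also have "(\<Sum>k<n. cl (t' k) *\<^sub>R x k) - (\<Sum>k<n. cl (t k) *\<^sub>R x k) = \<epsilon> *\<^sub>R (\<Sum>k<n. a' k *\<^sub>R x k)"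
          unfolding cl_id sum_subtractf[symmetric] scaleR_sum_right
          by (intro sum.cong) (auto simp: t'_def algebra_simps)
        finally show "norm (h n (\<lambda>k. t k + (if k < n then \<epsilon> * a' k else 0)) - h n t)
            \<le> \<epsilon> * norm (\<Sum>k<N. a k *\<^sub>R x k)"
          using \<epsilon> by (simp add: restr t'_def[abs_def])
      qed
      then show ?thesis by (simp add: restr z_def)
    qed
    then show "norm (\<Sum>k<N. a k *\<^sub>R R k) \<le> norm (\<Sum>k<N. a k *\<^sub>R x k)"
      by (intro tendsto_upperbound[OF lim]) (auto simp: eventually_sequentially)
  next
    fix f :: "'y \<Rightarrow> real" and g k
    assume f: "bounded_linear f" and fg: "\<And>u v. \<lbrakk>u \<in> D; v \<in> D\<rbrakk> \<Longrightarrow> f (\<phi> u - \<phi> v) = g (u - v)"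
    have "f (z k n) = g (x k)" if n: "k < n" for n
      unfolding z_def
    proof (rule cube_mean_functional_const[OF f \<Delta>])
      fix \<tau>
      have "f (\<Delta> n k \<tau>) = g ((\<Sum>j<n. cl ((\<tau>(k := 1)) j) *\<^sub>R x j) - (\<Sum>j<n. cl ((\<tau>(k := 0)) j) *\<^sub>R x j))"
        unfolding \<Delta>_def h_def by (intro fg inD)
      also have "(\<Sum>j<n. cl ((\<tau>(k := 1)) j) *\<^sub>R x j) - (\<Sum>j<n. cl ((\<tau>(k := 0)) j) *\<^sub>R x j) =
        (\<Sum>j<n. if j = k then x k else 0)"
        unfolding sum_subtractf[symmetric] by (intro sum.cong) (auto simp: cl_def)
      also have "\<dots> = x k" using n by simp
      finally show "f (\<Delta> n k \<tau>) = g (x k)" .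
    qed
    then have "\<forall>\<^sub>F n in sequentially. f (z k n) = g (x k)"
      by (auto simp: eventually_sequentially intro!: exI[of _ "Suc k"])
    then have "(\<lambda>n. f (z k n)) \<longlonglongrightarrow> g (x k)"
      by (rule tendsto_eventually)
    moreover have "(\<lambda>n. f (z k n)) \<longlonglongrightarrow> f (R k)"
      by (intro bounded_linear.tendsto[OF f] conv)
    ultimately show "f (R k) = g (x k)"
      by (metis LIMSEQ_unique)
  qed
qed

section \<open>The compact set \<open>K0\<close>\<close>

lemma C01_memI:
  assumes "f \<in> extensional {0..1}" "continuous_on {0..1} f"
  shows "f \<in> mspace C01"
proof -
  have "bounded (f ` {0..1})"
    using assms by (intro compact_imp_bounded compact_continuous_image) auto
  then show ?thesis
    using assms by (simp add: C01_def)
qed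

lemma C01_mem:
  assumes "f \<in> mspace C01"
  shows "f \<in> extensional {0..1}" "continuous_on {0..1} f"
  using assms by (simp_all add: C01_def)

lemma mdist_C01_le_iff:
  assumes "f \<in> mspace C01" "g \<in> mspace C01"
  shows "mdist C01 f g \<le> B \<longleftrightarrow> (\<forall>x\<in>{0..1}. \<bar>f x - g x\<bar> \<le> B)"
  using cfunspace_mdist_le[of f "top_of_set {0..1}" euclidean_metric g B] assms
  by (simp add: C01_def dist_real_def)

lemma lip_norm_le_1_iff:
  "lip_norm f \<le> 1 \<longleftrightarrow> (\<forall>x\<in>{0..1}. \<forall>y\<in>{0..1}. \<bar>f x - f y\<bar> \<le> \<bar>x - y\<bar>)"
proof (intro iffI ballI)
  fix x y :: real
  assume le: "lip_norm f \<le> 1" and xy: "x \<in> {0..1}" "y \<in> {0..1}"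
  show "\<bar>f x - f y\<bar> \<le> \<bar>x - y\<bar>"
  proof (cases "x = y")
    case False
    then have "ereal (\<bar>f x - f y\<bar> / \<bar>x - y\<bar>) \<le> lip_norm f"
      unfolding lip_norm_def using xy by (intro Sup_upper) blast
    also note le
    finally have "\<bar>f x - f y\<bar> / \<bar>x - y\<bar> \<le> 1"
      by (simp add: one_ereal_def)
    then show ?thesis
      using False by (simp add: divide_le_eq)
  qed simp
next
  assume lip: "\<forall>x\<in>{0..1}. \<forall>y\<in>{0..1}. \<bar>f x - f y\<bar> \<le> \<bar>x - y\<bar>"
  show "lip_norm f \<le> 1"
    unfolding lip_norm_def
  proof (rule Sup_least)
    fix z assume "z \<in> {ereal (\<bar>f x - f y\<bar> / \<bar>x - y\<bar>) | x y. x \<in> {0..1} \<and> y \<in> {0..1} \<and> x \<noteq> y}"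
    then obtain x y where z: "z = ereal (\<bar>f x - f y\<bar> / \<bar>x - y\<bar>)"
      and xy: "x \<in> {0..1}" "y \<in> {0..1}" "x \<noteq> y" by blast
    have "\<bar>f x - f y\<bar> \<le> \<bar>x - y\<bar>"
      using lip xy by blast
    then show "z \<le> 1"
      using xy(3) by (simp add: z one_ereal_def divide_le_eq)
  qed
qed

lemma K0_iff:
  "f \<in> K0 \<longleftrightarrow> f \<in> extensional {0..1} \<and> (\<forall>x\<in>{0..1}. \<bar>f x\<bar> \<le> 1) \<and>
    (\<forall>x\<in>{0..1}. \<forall>y\<in>{0..1}. \<bar>f x - f y\<bar> \<le> \<bar>x - y\<bar>)"
proof -
  have sup: "sup_norm f \<le> 1 \<longleftrightarrow> (\<forall>x\<in>{0..1}. \<bar>f x\<bar> \<le> 1)" if "f \<in> mspace C01"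
  proof -
    have "compact ((\<lambda>x. \<bar>f x\<bar>) ` {0..1})"
      using C01_mem(2)[OF that] by (intro compact_continuous_image continuous_intros) auto
    then have "bdd_above ((\<lambda>x. \<bar>f x\<bar>) ` {0..1})"
      by (intro bounded_imp_bdd_above compact_imp_bounded)
    then show ?thesis
      unfolding sup_norm_def by (subst cSUP_le_iff) auto
  qed
  have "f \<in> mspace C01" if "f \<in> extensional {0..1}" "\<forall>x\<in>{0..1}. \<forall>y\<in>{0..1}. \<bar>f x - f y\<bar> \<le> \<bar>x - y\<bar>"
    using that by (intro C01_memI lipschitz_on_continuous_on[of 1] lipschitz_onI) (auto simp: dist_real_def)
  then show ?thesis
    using sup C01_mem(1) unfolding K0_def by (auto simp: lip_norm_le_1_iff)
qed

lemma K0_subset: "K0 \<subseteq> mspace C01"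
  by (auto simp: K0_def)

lemma compactin_K0: "compactin (mtopology_of C01) K0"
proof -
  interpret Metric_space "mspace C01" "mdist C01"
    by simp
  have "\<exists>l r. l \<in> K0 \<and> strict_mono r \<and> limitin mtopology (\<sigma> \<circ> r) l sequentially"
    if \<sigma>: "range \<sigma> \<subseteq> K0" for \<sigma> :: "nat \<Rightarrow> real \<Rightarrow> real"
  proof -
    have mem: "\<sigma> n \<in> K0" for n
      using \<sigma> by auto
    have b: "\<bar>\<sigma> n x\<bar> \<le> 1" if "x \<in> {0..1}" for n x
      using mem[of n] that by (auto simp: K0_iff)
    have lip: "\<bar>\<sigma> n x - \<sigma> n y\<bar> \<le> \<bar>x - y\<bar>" if "x \<in> {0..1}" "y \<in> {0..1}" for n x y
      using mem[of n] that by (auto simp: K0_iff)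
    obtain g r where g: "continuous_on {0..1} g" and r: "strict_mono (r :: nat \<Rightarrow> nat)"
      and lim: "\<And>e. 0 < e \<Longrightarrow> \<exists>N. \<forall>n x. n \<ge> N \<and> x \<in> {0..1} \<longrightarrow> norm (\<sigma> (r n) x - g x) < e"
    proof (rule Arzela_Ascoli[of "{0..1::real}" \<sigma> 1])
      show "\<exists>d>0. \<forall>n y. y \<in> {0..1} \<and> norm (x - y) < d \<longrightarrow> norm (\<sigma> n x - \<sigma> n y) < e"
        if "x \<in> {0..1}" "0 < e" for x e
        using that lip by (intro exI[of _ e]) (auto intro: le_less_trans)
    qed (use b in auto)
    define l where "l = restrict g {0..1}"
    have pt: "(\<lambda>n. \<sigma> (r n) x) \<longlonglongrightarrow> l x" if "x \<in> {0..1}" for x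
    proof (rule LIMSEQ_I)
      fix e :: real assume "0 < e"
      then show "\<exists>N. \<forall>n\<ge>N. norm (\<sigma> (r n) x - l x) < e"
        using lim[of e] that by (auto simp: l_def)
    qed
    have "l \<in> K0"
      unfolding K0_iff
    proof (intro conjI ballI)
      show "l \<in> extensional {0..1}" by (simp add: l_def)
      show "\<bar>l x\<bar> \<le> 1" if "x \<in> {0..1}" for x
        using b that by (intro tendsto_upperbound[OF tendsto_rabs[OF pt]]) auto
      show "\<bar>l x - l y\<bar> \<le> \<bar>x - y\<bar>" if "x \<in> {0..1}" "y \<in> {0..1}" for x y
        using lip that by (intro tendsto_upperbound[OF tendsto_rabs[OF tendsto_diff[OF pt pt]]]) auto
    qed
    moreover have "limitin mtopology (\<sigma> \<circ> r) l sequentially"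
      unfolding limitin_metric
    proof (intro conjI allI impI)
      show lC: "l \<in> mspace C01" using \<open>l \<in> K0\<close> K0_subset by blast
      fix e :: real assume "0 < e"
      then obtain N where N: "\<And>n x. n \<ge> N \<Longrightarrow> x \<in> {0..1} \<Longrightarrow> \<bar>\<sigma> (r n) x - l x\<bar> < e / 2"
        using lim[of "e/2"] by (auto simp: l_def)
      have "(\<sigma> \<circ> r) n \<in> mspace C01 \<and> mdist C01 ((\<sigma> \<circ> r) n) l < e" if "n \<ge> N" for n
      proof
        show mem: "(\<sigma> \<circ> r) n \<in> mspace C01" using \<sigma> K0_subset by auto
        have "mdist C01 ((\<sigma> \<circ> r) n) l \<le> e / 2"
          unfolding mdist_C01_le_iff[OF mem lC] using N[OF that] by (auto intro: less_imp_le)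
        then show "mdist C01 ((\<sigma> \<circ> r) n) l < e" using \<open>0 < e\<close> by simp
      qed
      then show "\<forall>\<^sub>F n in sequentially. (\<sigma> \<circ> r) n \<in> mspace C01 \<and> mdist C01 ((\<sigma> \<circ> r) n) l < e"
        unfolding eventually_sequentially by blast
    qed
    ultimately show ?thesis using r by blast
  qed
  then have "compactin mtopology K0"
    unfolding compactin_sequentially using K0_subset by blast
  then show ?thesis by (simp add: mtopology_of_def)
qed

text \<open>
  The functions \<open>p = 1 - \<bar>t - \<tau>\<bar>\<close> and \<open>q = -p\<close> are at distance \<open>2\<close>, while \<open>u\<close> has distance at most \<open>1 - u \<tau>\<close> from \<open>p\<close>
  and at most \<open>1 + u \<tau>\<close> from \<open>q\<close>. Indeed \<open>p - u \<le> 1 - u \<tau>\<close> everywhere because \<open>u\<close> cannot fall faster than \<open>p\<close>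
  does, while \<open>u - p \<le> 1 - u \<tau>\<close> follows from the bound \<open>1/2\<close>, and \<open>q\<close> is symmetric to this. A functional of
  norm one that is norming for \<open>\<phi> p - \<phi> q\<close> has no slack on this path, so its value at \<open>\<phi> u\<close> is determined.
\<close>

lemma evaluation_functional:
  fixes \<phi> :: "(real \<Rightarrow> real) \<Rightarrow> 'y::real_normed_vector"
  assumes iso: "\<And>f g. \<lbrakk>f \<in> K0; g \<in> K0\<rbrakk> \<Longrightarrow> norm (\<phi> f - \<phi> g) = mdist C01 f g"
    and \<tau>: "\<tau> \<in> {0..1}"
  obtains F :: "'y \<Rightarrow> real" where "linear F" "\<And>y. \<bar>F y\<bar> \<le> norm y"
    "\<And>u v. \<lbrakk>u \<in> K0; v \<in> K0; \<And>t. t \<in> {0..1} \<Longrightarrow> \<bar>u t\<bar> \<le> 1/2; \<And>t. t \<in> {0..1} \<Longrightarrow> \<bar>v t\<bar> \<le> 1/2\<rbrakk>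
      \<Longrightarrow> F (\<phi> u - \<phi> v) = u \<tau> - v \<tau>"
proof -
  define p where "p = restrict (\<lambda>t. 1 - \<bar>t - \<tau>\<bar>) {0..1}"
  define q where "q = restrict (\<lambda>t. \<bar>t - \<tau>\<bar> - 1) {0..1}"
  have peak_in_K0: "restrict f {0..1} \<in> K0"
    if f: "\<And>t. \<bar>f t\<bar> = \<bar>1 - \<bar>t - \<tau>\<bar>\<bar>" "\<And>t s. \<bar>f t - f s\<bar> = \<bar>\<bar>t - \<tau>\<bar> - \<bar>s - \<tau>\<bar>\<bar>" for f :: "real \<Rightarrow> real"
    unfolding K0_iff
  proof (intro conjI ballI)
    fix t s :: real assume t: "t \<in> {0..1}" and s: "s \<in> {0..1}"
    have "0 \<le> t" "t \<le> 1" "0 \<le> \<tau>" "\<tau> \<le> 1" using t \<tau> by auto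
    then have "\<bar>1 - \<bar>t - \<tau>\<bar>\<bar> \<le> 1" by linarith
    then show "\<bar>restrict f {0..1} t\<bar> \<le> 1" using t f(1) by simp
    have "\<bar>\<bar>t - \<tau>\<bar> - \<bar>s - \<tau>\<bar>\<bar> \<le> \<bar>t - s\<bar>" by linarith
    then show "\<bar>restrict f {0..1} t - restrict f {0..1} s\<bar> \<le> \<bar>t - s\<bar>" using t s f(2) by simp
  qed simp
  have pK: "p \<in> K0" and qK: "q \<in> K0"
    unfolding p_def q_def by (rule peak_in_K0; linarith)+
  have mem: "p \<in> mspace C01" "q \<in> mspace C01"
    using pK qK K0_subset by auto
  have "2 \<le> mdist C01 p q"
    using mdist_C01_le_iff[OF mem, of "mdist C01 p q"] \<tau> by (auto simp: p_def q_def dest: bspec[of _ _ \<tau>])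
  then have pq: "2 \<le> norm (\<phi> p - \<phi> q)"
    using iso[OF pK qK] by simp
  obtain F where F: "linear F" "\<And>y. \<bar>F y\<bar> \<le> norm y" "F (\<phi> p - \<phi> q) = norm (\<phi> p - \<phi> q)"
    using norming_functional_exists[of "\<phi> p - \<phi> q"] by blast
  have val: "F (\<phi> u) = F (\<phi> p) - 1 + u \<tau>"
    if u: "u \<in> K0" and half: "\<And>t. t \<in> {0..1} \<Longrightarrow> \<bar>u t\<bar> \<le> 1/2" for u
  proof -
    have uC: "u \<in> mspace C01" using u K0_subset by auto
    have lip: "\<bar>u t - u \<tau>\<bar> \<le> \<bar>t - \<tau>\<bar>" and uh: "\<bar>u t\<bar> \<le> 1/2" "\<bar>u \<tau>\<bar> \<le> 1/2" and
      tt: "\<bar>t - \<tau>\<bar> \<le> 1" if "t \<in> {0..1}" for t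
      using u \<tau> that half by (auto simp: K0_iff abs_le_iff)
    have "mdist C01 p u \<le> 1 - u \<tau>"
      unfolding mdist_C01_le_iff[OF mem(1) uC]
    proof
      fix t :: real assume t: "t \<in> {0..1}"
      show "\<bar>p t - u t\<bar> \<le> 1 - u \<tau>"
        using lip[OF t] uh[OF t] tt[OF t] t unfolding p_def by (simp add: abs_le_iff) linarith
    qed
    moreover have "mdist C01 u q \<le> 1 + u \<tau>"
      unfolding mdist_C01_le_iff[OF uC mem(2)]
    proof
      fix t :: real assume t: "t \<in> {0..1}"
      show "\<bar>u t - q t\<bar> \<le> 1 + u \<tau>"
        using lip[OF t] uh[OF t] tt[OF t] t unfolding q_def by (simp add: abs_le_iff) linarith
    qed
    ultimately have "F (\<phi> p - \<phi> u) \<le> 1 - u \<tau>" "F (\<phi> u - \<phi> q) \<le> 1 + u \<tau>"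
      using F(2)[of "\<phi> p - \<phi> u"] F(2)[of "\<phi> u - \<phi> q"] iso[OF pK u] iso[OF u qK] by linarith+
    then show ?thesis
      using pq F(3) by (simp add: linear_diff[OF F(1)])
  qed
  show ?thesis
  proof (rule that[OF F(1,2)])
    fix u v assume "u \<in> K0" "v \<in> K0" "\<And>t. t \<in> {0..1} \<Longrightarrow> \<bar>u t\<bar> \<le> 1/2" "\<And>t. t \<in> {0..1} \<Longrightarrow> \<bar>v t\<bar> \<le> 1/2"
    then show "F (\<phi> u - \<phi> v) = u \<tau> - v \<tau>"
      using val[of u] val[of v] by (simp add: linear_diff[OF F(1)])
  qed
qed

section \<open>From a copy of \<open>K0\<close> to a linear copy of \<open>C([0,1])\<close>\<close>

lemma subspace_closure:
  fixes S :: "'a::real_normed_vector set"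
  assumes S: "subspace S"
  shows "subspace (closure S)"
proof (rule subspaceI)
  show "0 \<in> closure S"
    using subspace_0[OF S] closure_subset by blast
next
  fix x y assume "x \<in> closure S" "y \<in> closure S"
  then obtain p q where "\<And>n. p n \<in> S" "p \<longlonglongrightarrow> x" "\<And>n. q n \<in> S" "q \<longlonglongrightarrow> y"
    unfolding closure_sequential by blast
  then show "x + y \<in> closure S"
    unfolding closure_sequential
    by (intro exI[of _ "\<lambda>n. p n + q n"]) (auto intro: subspace_add[OF S] tendsto_add)
next
  fix c x assume "x \<in> closure S"
  then obtain p where "\<And>n. p n \<in> S" "p \<longlonglongrightarrow> x"
    unfolding closure_sequential by blast
  then show "c *\<^sub>R x \<in> closure S"
    unfolding closure_sequential
    by (intro exI[of _ "\<lambda>n. c *\<^sub>R p n"]) (auto intro: subspace_scale[OF S] tendsto_intros)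
qed

text \<open>
  The operator is given by its graph \<open>S\<close>, a subspace of the product. An isometric graph is single-valued
  because \<open>(0, w) \<in> S\<close> forces \<open>w = 0\<close>, so well-definedness and linearity need no choice of representations
  of \<open>u\<close> as a linear combination, and the extension is the closure of the graph.
\<close>

lemma isometric_graph_extension:
  fixes S :: "('v::real_normed_vector \<times> 'y::banach) set"
  assumes S: "subspace S" and iso: "\<And>u w. (u, w) \<in> S \<Longrightarrow> norm w = norm u"
  obtains T :: "'v \<Rightarrow> 'y" where "\<And>u. u \<in> closure (fst ` S) \<Longrightarrow> norm (T u) = norm u"
    "\<And>u v a b. \<lbrakk>u \<in> closure (fst ` S); v \<in> closure (fst ` S)\<rbrakk> \<Longrightarrow>
        T (a *\<^sub>R u + b *\<^sub>R v) = a *\<^sub>R T u + b *\<^sub>R T v"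
proof -
  have cS: "subspace (closure S)"
    by (rule subspace_closure[OF S])
  have isoc: "norm w = norm u" if uw: "(u, w) \<in> closure S" for u w
  proof -
    obtain p where p: "\<And>n. p n \<in> S" "p \<longlonglongrightarrow> (u, w)"
      using uw unfolding closure_sequential by blast
    have "(\<lambda>n. norm (fst (p n))) \<longlonglongrightarrow> norm u" "(\<lambda>n. norm (snd (p n))) \<longlonglongrightarrow> norm w"
      using tendsto_norm[OF tendsto_fst[OF p(2)]] tendsto_norm[OF tendsto_snd[OF p(2)]] by simp_all
    moreover have "norm (snd (p n)) = norm (fst (p n))" for n
      using iso[of "fst (p n)" "snd (p n)"] p(1) by simp
    ultimately show ?thesis using LIMSEQ_unique by auto
  qed
  have uniq: "w = w'" if "(u, w) \<in> closure S" "(u, w') \<in> closure S" for u w w'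
    using isoc[of 0 "w - w'"] subspace_diff[OF cS that] by simp
  have ex: "\<exists>w. (u, w) \<in> closure S" if u: "u \<in> closure (fst ` S)" for u
  proof -
    obtain q where q: "\<And>n. q n \<in> fst ` S" "q \<longlonglongrightarrow> u"
      using u unfolding closure_sequential by blast
    then have "\<forall>n. \<exists>w. (q n, w) \<in> S" by force
    then obtain w where w: "\<And>n. (q n, w n) \<in> S" by metis
    have "norm (w m - w n) = norm (q m - q n)" for m n
      using iso subspace_diff[OF S w[of m] w[of n]] by simp
    then have "Cauchy w"
      using LIMSEQ_imp_Cauchy[OF q(2)] by (simp add: Cauchy_def dist_norm)
    then obtain l where "w \<longlonglongrightarrow> l"
      using Cauchy_convergent convergent_def by blast
    then have "(\<lambda>n. (q n, w n)) \<longlonglongrightarrow> (u, l)"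
      using q(2) by (intro tendsto_Pair)
    then have "(u, l) \<in> closure S"
      unfolding closure_sequential using w by (intro exI[of _ "\<lambda>n. (q n, w n)"]) auto
    then show ?thesis by blast
  qed
  define T where "T u = (THE w. (u, w) \<in> closure S)" for u
  have T: "T u = w" if "(u, w) \<in> closure S" for u w
    unfolding T_def using that uniq by blast
  show ?thesis
  proof (rule that[of T])
    show "norm (T u) = norm u" if "u \<in> closure (fst ` S)" for u
      using ex[OF that] isoc T by metis
    show "T (a *\<^sub>R u + b *\<^sub>R v) = a *\<^sub>R T u + b *\<^sub>R T v"
      if uv: "u \<in> closure (fst ` S)" "v \<in> closure (fst ` S)" for u v a b
    proof -
      obtain w z where wz: "(u, w) \<in> closure S" "(v, z) \<in> closure S"
        using ex uv by blast
      have "a *\<^sub>R (u, w) + b *\<^sub>R (v, z) \<in> closure S"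
        by (intro subspace_add subspace_scale cS wz)
      then show ?thesis using T wz by simp
    qed
  qed
qed

lemma span_range_nat:
  fixes z :: "nat \<Rightarrow> 'a::real_vector"
  assumes "p \<in> span (range z)"
  shows "\<exists>n a. p = (\<Sum>k<n. a k *\<^sub>R z k)"
  using assms
proof (induction rule: span_induct_alt)
  case base
  show ?case by (intro exI[of _ 0]) simp
next
  case (step c x y)
  then obtain j n a where x: "x = z j" and y: "y = (\<Sum>k<n. a k *\<^sub>R z k)"
    by blast
  define N where "N = max n (Suc j)"
  have "j < N" by (simp add: N_def)
  have "(\<Sum>k<N. ((if k < n then a k else 0) + (if k = j then c else 0)) *\<^sub>R z k) =
    (\<Sum>k<N. (if k < n then a k else 0) *\<^sub>R z k) + (\<Sum>k<N. (if k = j then c *\<^sub>R z j else 0))"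
    unfolding sum.distrib[symmetric] by (intro sum.cong) (auto simp: scaleR_add_left)
  also have "(\<Sum>k<N. (if k < n then a k else 0) *\<^sub>R z k) = y"
    unfolding y by (intro sum.mono_neutral_cong_right) (auto simp: N_def)
  also have "(\<Sum>k<N. (if k = j then c *\<^sub>R z j else 0)) = c *\<^sub>R x"
    using \<open>j < N\<close> by (simp add: x)
  finally show ?case by (metis add.commute)
qed

text \<open>
  The normed space \<open>C([0,1])\<close> is modelled inside the Banach space of bounded continuous functions on
  the line, by functions that are constant to the left of \<open>0\<close> and to the right of \<open>1\<close>. The norm is then the
  supremum over \<open>[0,1]\<close>.
\<close>

definition extend01 :: "(real \<Rightarrow> real) \<Rightarrow> real \<Rightarrow>\<^sub>C real" where
  "extend01 f = Bcontfun (\<lambda>x. f (max 0 (min 1 x)))"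

lemma extend01_apply:
  assumes "continuous_on {0..1} f"
  shows "apply_bcontfun (extend01 f) x = f (max 0 (min 1 x))"
proof -
  have "bounded (f ` {0..1})"
    using assms by (intro compact_imp_bounded compact_continuous_image) auto
  moreover have "range (\<lambda>x. f (max 0 (min 1 x))) \<subseteq> f ` {0..1}"
    by auto
  ultimately have "bounded (range (\<lambda>x. f (max 0 (min 1 x))))"
    by (rule bounded_subset)
  moreover have "continuous_on UNIV (\<lambda>x. f (max 0 (min 1 x)))"
    by (rule continuous_on_compose2[OF assms]) (auto intro!: continuous_intros)
  ultimately show ?thesis
    unfolding extend01_def by (subst Bcontfun_inverse) (auto simp: bcontfun_def)
qed

lemma extend01_cong: "(\<And>t. t \<in> {0..1} \<Longrightarrow> f t = g t) \<Longrightarrow> extend01 f = extend01 g"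
  unfolding extend01_def by (intro arg_cong[of _ _ Bcontfun] ext) auto

lemma extend01_linear:
  assumes "continuous_on {0..1} f" "continuous_on {0..1} g"
  shows "extend01 (\<lambda>t. a * f t + b * g t) = a *\<^sub>R extend01 f + b *\<^sub>R extend01 g"
  using assms by (intro bcontfun_eqI) (simp add: extend01_apply continuous_intros)

lemma norm_extend01_le:
  assumes "continuous_on {0..1} f" "\<And>t. t \<in> {0..1} \<Longrightarrow> \<bar>f t\<bar> \<le> B"
  shows "norm (extend01 f) \<le> B"
  using assms by (intro norm_bound) (simp add: extend01_apply)

lemma abs_le_norm_extend01:
  assumes "continuous_on {0..1} f" "t \<in> {0..1}"
  shows "\<bar>f t\<bar> \<le> norm (extend01 f)"
  using norm_bounded[of "extend01 f" t] assms by (simp add: extend01_apply)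

text \<open>
  Scaled monomials \<open>x k = t\<^sup>k / 8\<^bsup>k+1\<^esup>\<close> are linearized. The factor makes every combination with coefficients in
  \<open>[-2, 2]\<close> an element of \<open>K0\<close> bounded by \<open>1/2\<close>: the sum is at most \<open>\<Sum> 2 / 8\<^bsup>k+1\<^esup>\<close>, and since the
  monomial \<open>t\<^sup>k\<close> has Lipschitz constant \<open>k \<le> 2\<^sup>k\<close> the Lipschitz constant is at most \<open>\<Sum> 2 \<cdot> 2\<^sup>k / 8\<^bsup>k+1\<^esup>\<close>. Both series
  are dominated by \<open>\<Sum> 1/4\<^bsup>k+1\<^esup> = 1/3\<close>.
\<close>

theorem C01_embeds_linearly:
  fixes \<phi> :: "(real \<Rightarrow> real) \<Rightarrow> 'y::banach"
  assumes iso: "\<And>f g. \<lbrakk>f \<in> K0; g \<in> K0\<rbrakk> \<Longrightarrow> norm (\<phi> f - \<phi> g) = mdist C01 f g"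
  obtains U :: "(real \<Rightarrow> real) \<Rightarrow> 'y" where
    "\<And>f g a b. \<lbrakk>continuous_on {0..1} f; continuous_on {0..1} g\<rbrakk> \<Longrightarrow>
        U (\<lambda>t. a * f t + b * g t) = a *\<^sub>R U f + b *\<^sub>R U g"
    "\<And>f. continuous_on {0..1} f \<Longrightarrow> norm (U f) = norm (extend01 f)"
    "\<And>f g. (\<And>t. t \<in> {0..1} \<Longrightarrow> f t = g t) \<Longrightarrow> U f = U g"
proof -
  define x where "x k = extend01 (\<lambda>t. t ^ k / 8 ^ Suc k)" for k :: nat
  have x: "apply_bcontfun (x k) t = t ^ k / 8 ^ Suc k" if "t \<in> {0..1}" for k t
    using that unfolding x_def by (subst extend01_apply) (auto intro!: continuous_intros)
  define D where "D = {u :: real \<Rightarrow>\<^sub>C real. restrict u {0..1} \<in> K0 \<and> (\<forall>t\<in>{0..1}. \<bar>u t\<bar> \<le> 1/2)}"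
  define \<psi> where "\<psi> u = \<phi> (restrict (apply_bcontfun u) {0..1})" for u
  have comb: "apply_bcontfun (\<Sum>k<n. a k *\<^sub>R x k) t = (\<Sum>k<n. a k * (t ^ k / 8 ^ Suc k))"
    if "t \<in> {0..1}" for a n t
    by (induction n) (simp_all add: x[OF that])
  have geo: "(\<Sum>k<n. 1/4 * (1/4 :: real) ^ k) \<le> 1/2" for n
  proof -
    have "(\<Sum>k<n. 1/4 * (1/4 :: real) ^ k) = 1/4 * ((1 - (1/4)^n) / (1 - 1/4))"
      unfolding sum_distrib_left[symmetric] by (subst sum_gp_strict) simp
    also have "\<dots> \<le> 1/4 * (1 / (1 - 1/4))"
      by (intro mult_left_mono divide_right_mono) auto
    finally show ?thesis by simp
  qed
  have inD: "(\<Sum>k<n. \<tau> k *\<^sub>R x k) \<in> D" if \<tau>: "\<And>k. \<bar>\<tau> k\<bar> \<le> 2" for \<tau> n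
  proof -
    have half: "\<bar>\<Sum>k<n. \<tau> k * (t ^ k / 8 ^ Suc k)\<bar> \<le> 1/2" if t: "t \<in> {0..1}" for t
    proof -
      have each: "\<bar>\<tau> k * (t ^ k / 8 ^ Suc k)\<bar> \<le> 1/4 * (1/4) ^ k" for k
      proof -
      have "\<bar>\<tau> k * (t ^ k / 8 ^ Suc k)\<bar> \<le> 2 * (1 / 8 ^ Suc k)"
        unfolding abs_mult using t by (intro mult_mono \<tau>) (auto simp: power_le_one divide_right_mono)
      also have "\<dots> \<le> 1/4 * (1/4) ^ k"
        by (simp add: power_divide frac_le power_mono)
      finally show ?thesis .
      qed
      have "\<bar>\<Sum>k<n. \<tau> k * (t ^ k / 8 ^ Suc k)\<bar> \<le> (\<Sum>k<n. \<bar>\<tau> k * (t ^ k / 8 ^ Suc k)\<bar>)"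
        by (rule sum_abs)
      also have "\<dots> \<le> (\<Sum>k<n. 1/4 * (1/4) ^ k)"
        by (intro sum_mono each)
      also note geo
      finally show ?thesis .
    qed
    have lip: "\<bar>(\<Sum>k<n. \<tau> k * (t ^ k / 8 ^ Suc k)) - (\<Sum>k<n. \<tau> k * (s ^ k / 8 ^ Suc k))\<bar> \<le> \<bar>t - s\<bar>"
      if t: "t \<in> {0..1}" and s: "s \<in> {0..1}" for t s
    proof -
      have "\<bar>(\<Sum>k<n. \<tau> k * (t ^ k / 8 ^ Suc k)) - (\<Sum>k<n. \<tau> k * (s ^ k / 8 ^ Suc k))\<bar>
        = \<bar>\<Sum>k<n. \<tau> k * ((t ^ k - s ^ k) / 8 ^ Suc k)\<bar>"
        unfolding sum_subtractf[symmetric] by (simp add: diff_divide_distrib right_diff_distrib)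
      also have "\<dots> \<le> (\<Sum>k<n. 1/4 * (1/4) ^ k * \<bar>t - s\<bar>)"
      proof (rule order_trans[OF sum_abs sum_mono])
        fix k
        have "\<bar>t ^ k - s ^ k\<bar> \<le> real k * \<bar>t - s\<bar>"
          using norm_power_diff[of t s k] t s by simp
        also have "\<dots> \<le> 2 ^ k * \<bar>t - s\<bar>"
          by (intro mult_right_mono) (auto simp: of_nat_less_two_power less_imp_le)
        finally have "\<bar>\<tau> k * ((t ^ k - s ^ k) / 8 ^ Suc k)\<bar> \<le> 2 * (2 ^ k * \<bar>t - s\<bar> / 8 ^ Suc k)"
          unfolding abs_mult by (intro mult_mono \<tau>) (auto simp: divide_right_mono)
        also have "2 * (2 ^ k * \<bar>t - s\<bar> / 8 ^ Suc k) = 1/4 * (1/4) ^ k * \<bar>t - s\<bar>"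
        proof -
          have "(8::real) ^ k = 2 ^ k * 4 ^ k"
            by (simp flip: power_mult_distrib)
          then show ?thesis by (simp add: power_divide)
        qed
        finally show "\<bar>\<tau> k * ((t ^ k - s ^ k) / 8 ^ Suc k)\<bar> \<le> 1/4 * (1/4) ^ k * \<bar>t - s\<bar>" .
      qed
      also have "\<dots> = (\<Sum>k<n. 1/4 * (1/4) ^ k) * \<bar>t - s\<bar>"
        by (simp add: sum_distrib_right)
      also have "\<dots> \<le> 1 * \<bar>t - s\<bar>"
        using geo[of n] by (intro mult_right_mono) auto
      finally show ?thesis by simp
    qed
    have "\<bar>\<Sum>k<n. \<tau> k * (t ^ k / 8 ^ Suc k)\<bar> \<le> 1" if "t \<in> {0..1}" for t
      using half[OF that] by linarith
    then show ?thesis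
      unfolding D_def mem_Collect_eq K0_iff
      using half lip by (simp add: comb del: power_Suc)
  qed
  have sumx: "summable (\<lambda>k. norm (x k))"
  proof (rule summable_comparison_test'[of "\<lambda>k. (1/8) ^ k" 0])
    show "summable (\<lambda>k. (1/8 :: real) ^ k)"
      by (rule summable_geometric) simp
    fix k :: nat
    have "norm (x k) \<le> (1/8) ^ k"
      unfolding x_def
    proof (rule norm_extend01_le)
      fix t :: real assume t: "t \<in> {0..1}"
      then have "\<bar>t ^ k / 8 ^ Suc k\<bar> \<le> 1 / 8 ^ k"
        by (auto simp: abs_divide power_le_one intro!: frac_le)
      then show "\<bar>t ^ k / 8 ^ Suc k\<bar> \<le> (1/8) ^ k"
        by (simp add: power_divide)
    qed (auto intro!: continuous_intros)
    then show "norm (norm (x k)) \<le> (1/8) ^ k" by simp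
  qed
  have lip: "norm (\<psi> u - \<psi> v) \<le> norm (u - v)" if "u \<in> D" "v \<in> D" for u v
  proof -
    have K: "restrict u {0..1} \<in> K0" "restrict v {0..1} \<in> K0"
      using that by (auto simp: D_def)
    then have "norm (\<psi> u - \<psi> v) = mdist C01 (restrict u {0..1}) (restrict v {0..1})"
      unfolding \<psi>_def by (rule iso)
    also have "\<dots> \<le> norm (u - v)"
      using K K0_subset norm_bounded[of "u - v"] by (subst mdist_C01_le_iff) auto
    finally show ?thesis .
  qed
  obtain R where R_le: "\<And>n a. norm (\<Sum>k<n. a k *\<^sub>R R k) \<le> norm (\<Sum>k<n. a k *\<^sub>R x k)"
    and R_fun: "\<And>(f :: 'y \<Rightarrow> real) g k. \<lbrakk>bounded_linear f; \<And>u v. \<lbrakk>u \<in> D; v \<in> D\<rbrakk> \<Longrightarrow> f (\<psi> u - \<psi> v) = g (u - v)\<rbrakk>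
      \<Longrightarrow> f (R k) = g (x k)"
    proof -
      show thesis by (rule linearize_lipschitz[of x D \<psi>]) (fact sumx inD lip that)+
    qed
  have R_ge: "norm (\<Sum>k<n. a k *\<^sub>R x k) \<le> norm (\<Sum>k<n. a k *\<^sub>R R k)" for n a
  proof -
    have "(\<Sum>k<n. a k *\<^sub>R x k) = extend01 (\<lambda>t. \<Sum>k<n. a k * (t ^ k / 8 ^ Suc k))"
    proof (rule bcontfun_eqI)
      fix s :: real
      have "apply_bcontfun (x k) s = apply_bcontfun (x k) (max 0 (min 1 s))" for k
        unfolding x_def by (simp add: extend01_apply continuous_intros)
      then have "apply_bcontfun (\<Sum>k<n. a k *\<^sub>R x k) s = apply_bcontfun (\<Sum>k<n. a k *\<^sub>R x k) (max 0 (min 1 s))"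
        by (induction n) simp_all
      then show "apply_bcontfun (\<Sum>k<n. a k *\<^sub>R x k) s =
         apply_bcontfun (extend01 (\<lambda>t. \<Sum>k<n. a k * (t ^ k / 8 ^ Suc k))) s"
        by (simp add: extend01_apply continuous_intros comb)
    qed
    also have "norm \<dots> \<le> norm (\<Sum>k<n. a k *\<^sub>R R k)"
    proof (rule norm_extend01_le)
      fix \<tau> :: real assume \<tau>: "\<tau> \<in> {0..1}"
      obtain F where F: "linear F" "\<And>y. \<bar>F y\<bar> \<le> norm y" and
        ev: "\<And>u v. \<lbrakk>u \<in> K0; v \<in> K0; \<And>t. t \<in> {0..1} \<Longrightarrow> \<bar>u t\<bar> \<le> 1/2; \<And>t. t \<in> {0..1} \<Longrightarrow> \<bar>v t\<bar> \<le> 1/2\<rbrakk>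
          \<Longrightarrow> F (\<phi> u - \<phi> v) = u \<tau> - v \<tau>"
        proof -
          show thesis by (rule evaluation_functional[of \<phi> \<tau>]) (fact iso \<tau> that)+
        qed
      have bl: "bounded_linear F"
        using F by (intro bounded_linear_intro[where K = 1]) (auto simp: linear_add linear_scale)
      have "F (R k) = apply_bcontfun (x k) \<tau>" for k
      proof (rule R_fun[OF bl])
        fix u v assume "u \<in> D" "v \<in> D"
        then show "F (\<psi> u - \<psi> v) = apply_bcontfun (u - v) \<tau>"
          unfolding \<psi>_def using \<tau> by (subst ev) (auto simp: D_def)
      qed
      then have "F (\<Sum>k<n. a k *\<^sub>R R k) = (\<Sum>k<n. a k * (\<tau> ^ k / 8 ^ Suc k))"
        using \<tau> by (simp add: linear_sum[OF F(1)] linear_scale[OF F(1)] x)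
      then show "\<bar>\<Sum>k<n. a k * (\<tau> ^ k / 8 ^ Suc k)\<bar> \<le> norm (\<Sum>k<n. a k *\<^sub>R R k)"
        using F(2) by metis
    qed (auto intro!: continuous_intros)
    finally show ?thesis .
  qed
  define S where "S = span (range (\<lambda>k. (x k, R k)))"
  have subS: "subspace S"
    unfolding S_def by (rule subspace_span)
  \<comment> \<open>The graph of \<open>x k \<mapsto> R k\<close> is isometric: linearization is a contraction, and the point
      evaluations factor through it.\<close>
  have isoS: "norm w = norm u" if "(u, w) \<in> S" for u w
  proof -
    obtain n a where "(u, w) = (\<Sum>k<n. a k *\<^sub>R (x k, R k))"
      using span_range_nat \<open>(u, w) \<in> S\<close> unfolding S_def by blast
    then have "u = (\<Sum>k<n. a k *\<^sub>R x k)" "w = (\<Sum>k<n. a k *\<^sub>R R k)"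
      by (auto simp: prod_eq_iff fst_sum snd_sum)
    then show ?thesis using R_le[of a n] R_ge[of a n] by simp
  qed
  obtain T :: "(real \<Rightarrow>\<^sub>C real) \<Rightarrow> 'y" where T: "\<And>u. u \<in> closure (fst ` S) \<Longrightarrow> norm (T u) = norm u"
    "\<And>u v a b. \<lbrakk>u \<in> closure (fst ` S); v \<in> closure (fst ` S)\<rbrakk> \<Longrightarrow>
        T (a *\<^sub>R u + b *\<^sub>R v) = a *\<^sub>R T u + b *\<^sub>R T v"
    proof -
      show thesis by (rule isometric_graph_extension[of S]) (fact subS isoS that)+
    qed
  have dense: "extend01 f \<in> closure (fst ` S)" if f: "continuous_on {0..1} f" for f
    unfolding closure_approachable
  proof (intro allI impI)
    fix e :: real assume e: "e > 0"
    obtain g where g: "real_polynomial_function g" "\<And>t. t \<in> {0..1} \<Longrightarrow> \<bar>f t - g t\<bar> < e / 2"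
      using Stone_Weierstrass_real_polynomial_function[OF _ f, of "e/2"] e by auto
    then obtain a n where ga: "g = (\<lambda>t. \<Sum>i\<le>n. a i * t ^ i)"
      unfolding real_polynomial_function_iff_sum by blast
    define u where "u = (\<Sum>k<Suc n. (a k * 8 ^ Suc k) *\<^sub>R x k)"
    have "(u, \<Sum>k<Suc n. (a k * 8 ^ Suc k) *\<^sub>R R k) = (\<Sum>k<Suc n. (a k * 8 ^ Suc k) *\<^sub>R (x k, R k))"
      by (simp add: prod_eq_iff fst_sum snd_sum u_def)
    also have "\<dots> \<in> S"
      unfolding S_def by (intro span_sum span_scale span_base) auto
    finally have uS: "u \<in> fst ` S" by force
    have cg: "continuous_on {0..1} g"
      unfolding ga by (intro continuous_intros)
    have "u = extend01 g"
    proof (rule bcontfun_eqI)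
      fix s :: real
      have "apply_bcontfun (x k) s = max 0 (min 1 s) ^ k / 8 ^ Suc k" for k
        unfolding x_def by (simp add: extend01_apply continuous_intros)
      then have "apply_bcontfun (\<Sum>k<m. (a k * 8 ^ Suc k) *\<^sub>R x k) s = (\<Sum>k<m. a k * max 0 (min 1 s) ^ k)" for m
        by (induction m) simp_all
      from this[of "Suc n"] have "apply_bcontfun u s = g (max 0 (min 1 s))"
        by (simp only: u_def ga lessThan_Suc_atMost)
      then show "apply_bcontfun u s = apply_bcontfun (extend01 g) s"
        by (simp only: extend01_apply[OF cg])
    qed
    then have "extend01 f - u = extend01 (\<lambda>t. 1 * f t + (-1) * g t)"
      using extend01_linear[OF f cg, of 1 "-1"] by simp
    also have "norm \<dots> \<le> e / 2"
      using g(2) by (intro norm_extend01_le continuous_intros f cg) (auto intro: less_imp_le)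
    finally have "dist u (extend01 f) < e"
      using e by (simp add: dist_norm norm_minus_commute)
    then show "\<exists>y\<in>fst ` S. dist y (extend01 f) < e"
      using uS by blast
  qed
  show ?thesis
  proof (rule that[of "\<lambda>f. T (extend01 f)"])
    show "T (extend01 (\<lambda>t. a * f t + b * g t)) = a *\<^sub>R T (extend01 f) + b *\<^sub>R T (extend01 g)"
      if "continuous_on {0..1} f" "continuous_on {0..1} g" for f g a b
      using that by (simp add: extend01_linear T dense)
    show "norm (T (extend01 f)) = norm (extend01 f)" if "continuous_on {0..1} f" for f
      using that by (simp add: T dense)
    show "T (extend01 f) = T (extend01 g)" if "\<And>t. t \<in> {0..1} \<Longrightarrow> f t = g t" for f g
      using extend01_cong[of f g] that by simp
  qed
qed

section \<open>Universality\<close>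

theorem corollary3p2:
  shows "compactin (mtopology_of C01) K0 \<and>
    (contains_isometric_copy TYPE('y::banach) (submetric C01 K0) \<longrightarrow>
      (\<forall>m :: 'm metric. separable_space (mtopology_of m) \<longrightarrow>
         contains_isometric_copy TYPE('y) m) \<and>
      (separable_space (euclidean :: 'b::banach topology) \<longrightarrow>
         linearly_isometric_into TYPE('b) TYPE('y)))"
proof (intro conjI impI compactin_K0)
  assume "contains_isometric_copy TYPE('y) (submetric C01 K0)"
  then obtain \<phi> :: "(real \<Rightarrow> real) \<Rightarrow> 'y" where
    \<phi>: "\<And>f g. \<lbrakk>f \<in> K0; g \<in> K0\<rbrakk> \<Longrightarrow> norm (\<phi> f - \<phi> g) = mdist C01 f g"
    using K0_subset unfolding contains_isometric_copy_def by (force simp: dist_norm)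
  obtain U :: "(real \<Rightarrow> real) \<Rightarrow> 'y" where
    U_lin: "\<And>f g a b. \<lbrakk>continuous_on {0..1} f; continuous_on {0..1} g\<rbrakk> \<Longrightarrow>
        U (\<lambda>t. a * f t + b * g t) = a *\<^sub>R U f + b *\<^sub>R U g"
    and U_norm: "\<And>f. continuous_on {0..1} f \<Longrightarrow> norm (U f) = norm (extend01 f)"
    and U_cong: "\<And>f g. (\<And>t. t \<in> {0..1} \<Longrightarrow> f t = g t) \<Longrightarrow> U f = U g"
  proof -
    show thesis by (rule C01_embeds_linearly[of \<phi>]) (fact \<phi> that)+
  qed
  have U_dist: "norm (U f - U g) = d"
    if f: "continuous_on {0..1} f" and g: "continuous_on {0..1} g"
      and le: "\<And>t. t \<in> {0..1} \<Longrightarrow> \<bar>f t - g t\<bar> \<le> d" and ex: "\<exists>t\<in>{0..1}. \<bar>f t - g t\<bar> = d" for f g d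
  proof -
    define h where "h t = f t - g t" for t
    have h: "continuous_on {0..1} h"
      unfolding h_def by (intro continuous_intros f g)
    have "U f - U g = U h"
      using U_lin[OF f g, of 1 "-1"] by (simp add: h_def[abs_def])
    moreover have "norm (extend01 h) \<le> d"
      using le by (intro norm_extend01_le h) (simp add: h_def)
    moreover have "d \<le> norm (extend01 h)"
      using ex abs_le_norm_extend01[OF h] by (auto simp: h_def)
    ultimately show ?thesis using U_norm[OF h] by simp
  qed
  show "\<forall>m :: 'm metric. separable_space (mtopology_of m) \<longrightarrow> contains_isometric_copy TYPE('y) m"
  proof (intro allI impI)
    fix m :: "'m metric" assume sep: "separable_space (mtopology_of m)"
    show "contains_isometric_copy TYPE('y) m"
    proof (cases "mspace m = {}")
      case True
      then show ?thesis by (simp add: contains_isometric_copy_def)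
    next
      case False
      then obtain x0 where x0: "x0 \<in> mspace m" by blast
      interpret Metric_space "mspace m" "mdist m" by simp
      \<comment> \<open>Subtracting the distance to a base point makes the distance functions pointwise
          bounded.\<close>
      define L where "L = (\<lambda>z x. mdist m x z - mdist m x0 z) ` mspace m"
      have tri: "\<bar>mdist m x z - mdist m y z\<bar> \<le> mdist m x y"
        if "x \<in> mspace m" "y \<in> mspace m" "z \<in> mspace m" for x y z
        using triangle[of x y z] triangle[of y x z] commute[of x y] that by simp
      obtain J :: "'m \<Rightarrow> real \<Rightarrow> real" where
        J: "\<And>x. x \<in> mspace m \<Longrightarrow> continuous_on {0..1} (J x)"
        "\<And>x y t. \<lbrakk>x \<in> mspace m; y \<in> mspace m; t \<in> {0..1}\<rbrakk> \<Longrightarrow> \<bar>J x t - J y t\<bar> \<le> mdist m x y"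
        "\<And>x y. \<lbrakk>x \<in> mspace m; y \<in> mspace m\<rbrakk> \<Longrightarrow> \<exists>t\<in>{0..1}. \<bar>J x t - J y t\<bar> = mdist m x y"
      proof -
        show thesis
        proof (rule universal_C01[OF sep False, of L])
          fix l x y assume "l \<in> L" "x \<in> mspace m" "y \<in> mspace m"
          then show "\<bar>l x - l y\<bar> \<le> mdist m x y"
            using tri by (force simp: L_def)
        next
          fix x assume "x \<in> mspace m"
          then show "\<exists>R. \<forall>l\<in>L. \<bar>l x\<bar> \<le> R"
            using tri[OF _ x0] by (auto simp: L_def)
        next
          fix x y assume "x \<in> mspace m" "y \<in> mspace m"
          then have "(\<lambda>x. mdist m x y - mdist m x0 y) \<in> L" "\<bar>mdist m x y - mdist m x0 y - (mdist m y y - mdist m x0 y)\<bar> = mdist m x y"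
            by (auto simp: L_def)
          then show "\<exists>l\<in>L. \<bar>l x - l y\<bar> = mdist m x y" by fast
        qed (rule that)
      qed
      have "dist (U (J x)) (U (J y)) = mdist m x y" if "x \<in> mspace m" "y \<in> mspace m" for x y
        unfolding dist_norm by (intro U_dist J that)
      then show ?thesis
        unfolding contains_isometric_copy_def by (intro exI[of _ "\<lambda>x. U (J x)"]) simp
    qed
  qed
  assume sep: "separable_space (euclidean :: 'b topology)"
  define L where "L = {l :: 'b \<Rightarrow> real. linear l \<and> (\<forall>x. \<bar>l x\<bar> \<le> norm x)}"
  have l_diff: "\<bar>l x - l y\<bar> \<le> dist x y" if "l \<in> L" for l x y
  proof -
    have "linear l" "\<bar>l (x - y)\<bar> \<le> norm (x - y)"
      using that by (simp_all add: L_def)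
    then show ?thesis by (simp add: dist_norm linear_diff)
  qed
  have l_norming: "\<exists>l\<in>L. \<bar>l x - l y\<bar> = dist x y" for x y
  proof -
    obtain l :: "'b \<Rightarrow> real" where l: "linear l" "\<And>x. \<bar>l x\<bar> \<le> norm x" "l (x - y) = norm (x - y)"
    proof -
      show thesis by (rule norming_functional_exists[of "x - y"]) (fact that)
    qed
    then have "l \<in> L" "\<bar>l x - l y\<bar> = dist x y"
      using linear_diff[OF l(1), of x y] by (simp_all add: L_def dist_norm)
    then show ?thesis by blast
  qed
  obtain J :: "'b \<Rightarrow> real \<Rightarrow> real" where
    J: "\<And>x. x \<in> mspace euclidean_metric \<Longrightarrow> continuous_on {0..1} (J x)"
    "\<And>x y t. \<lbrakk>x \<in> mspace euclidean_metric; y \<in> mspace euclidean_metric; t \<in> {0..1}\<rbrakk> \<Longrightarrow>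
       \<bar>J x t - J y t\<bar> \<le> mdist euclidean_metric x y"
    "\<And>x y. \<lbrakk>x \<in> mspace euclidean_metric; y \<in> mspace euclidean_metric\<rbrakk> \<Longrightarrow>
       \<exists>t\<in>{0..1}. \<bar>J x t - J y t\<bar> = mdist euclidean_metric x y"
    "\<And>x y z a b t. \<lbrakk>x \<in> mspace euclidean_metric; y \<in> mspace euclidean_metric; z \<in> mspace euclidean_metric;
       t \<in> {0..1}; \<And>l. l \<in> L \<Longrightarrow> l z = a * l x + b * l y\<rbrakk> \<Longrightarrow> J z t = a * J x t + b * J y t"
  proof -
    show thesis
    proof (rule universal_C01[of "euclidean_metric :: 'b metric" L])
      show "separable_space (mtopology_of (euclidean_metric :: 'b metric))" using sep by simp
      show "\<exists>R. \<forall>l\<in>L. \<bar>l x\<bar> \<le> R" for x by (auto simp: L_def)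
      show "\<bar>l x - l y\<bar> \<le> mdist euclidean_metric x y" if "l \<in> L" for l x y
        using l_diff[OF that] by simp
      show "\<exists>l\<in>L. \<bar>l x - l y\<bar> = mdist euclidean_metric x y" for x y
        using l_norming by simp
    qed (simp, fact that)
  qed
  have J_cont: "continuous_on {0..1} (J x)" for x
    using J(1) by simp
  define T where "T x = U (J x)" for x
  have lin: "T (a *\<^sub>R x + b *\<^sub>R y) = a *\<^sub>R T x + b *\<^sub>R T y" for a b x y
  proof -
    have "T (a *\<^sub>R x + b *\<^sub>R y) = U (\<lambda>t. a * J x t + b * J y t)"
      unfolding T_def by (intro U_cong J(4)) (simp_all add: L_def linear_add linear_scale)
    then show ?thesis
      unfolding T_def using U_lin[OF J_cont J_cont] by simp
  qed
  have "linear T"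
    using lin[of 1 _ 1] lin[of _ _ 0] by (intro linearI) auto
  moreover have "norm (T x) = norm x" for x
  proof -
    have "norm (T x - T 0) = dist x 0"
      unfolding T_def using J(2)[of x 0] J(3)[of x 0] by (intro U_dist J_cont) simp_all
    then show ?thesis using linear_0[OF \<open>linear T\<close>] by simp
  qed
  ultimately show "linearly_isometric_into TYPE('b) TYPE('y)"
    unfolding linearly_isometric_into_def by (intro exI[of _ T]) simp
qed

end
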